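(* Let $\mathcal{A}$ be a compact Hausdorff abelian group, let $\varrho$ be a substitution of constant length $L$ on $\mathcal{A}$ such that all columns $\varrho_j$, $0\le j\le L-1$, are group translations, let $w\in X_\varrho$ be a pseudo-fixed point of $\varrho$, let $\chi\in\widehat{\mathcal{A}}$, and let $\omega=\sum_{m\in\mathbb{Z}}\chi(w_m)\delta_m$ be the associated weighted Dirac comb, with autocorrelation coefficients $\eta(m)$. If $|\eta(1)|<1$, then the diffraction $\widehat{\gamma}$ of $\omega$ is purely singular continuous.
   Context: Substitutions. An alphabet $\mathcal{A}$ is a compact Hausdorff space; $\mathcal{A}^+=\bigsqcup_{n\ge1}\mathcal{A}^n$ is the space of finite non-empty words. A substitution is a continuous map $\varrho\colon\mathcal{A}\to\mathcal{A}^+$, extended to words and bi-infinite sequences by concatenation (in $\varrho(w)$ the word $\varrho(w_0)$ begins at position $0$); it is always assumed that $|\varrho(a)|\ge 2$ for some $a$. It has constant length $L$ if $\varrho(\mathcal{A})\subset\mathcal{A}^L$ (so $L\ge2$); its columns are the maps $\varrho_j(a)=(\varrho(a))_j$, $0\le j\le L-1$. A column is a group translation if $\varrho_j(a)=\beta_j a$ for some $\beta_j\in\mathcal{A}$. $\mathcal{L}^n(\varrho)$ is the closure in $\mathcal{A}^n$ of the set of length-$n$ words that occur as subwords of some $\varrho^k(a)$, $a\in\mathcal{A}$, $k\ge1$. The subshift is $X_\varrho=\{w\in\mathcal{A}^{\mathbb{Z}} : w_{[i,j]}\in\mathcal{L}^{j-i+1}(\varrho)\text{ for all } i\le j\}$,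 with left shift $\sigma(w)_n=w_{n+1}$. A pseudo-fixed point of a constant-length-$L$ substitution $\varrho$ is $w\in X_\varrho$ with $\varrho(w)=\sigma^s(w)$ for some $0\le s\le L-1$. Diffraction. $\widehat{\mathcal{A}}$ is the set of continuous homomorphisms $\chi\colon\mathcal{A}\to S^1\subset\mathbb{C}$. The autocorrelation coefficients of $\omega$ are $\eta(m)=\lim_{N\to\infty}\frac{1}{2N+1}\sum_{j=-N}^{N}\chi(w_j)\overline{\chi(w_{j+m})}$ (these limits exist in this setting), the autocorrelation is $\gamma=\sum_{m\in\mathbb{Z}}\eta(m)\delta_m$, and the diffraction measure $\widehat{\gamma}$ is its Fourier transform, a positive $\mathbb{Z}$-periodic measure on $\mathbb{R}$: it is the $\mathbb{Z}$-periodisation of the positive measure on $\mathbb{T}=\mathbb{R}/\mathbb{Z}$ whose Fourier coefficients are $\eta(m)$. Lebesgue decomposition: $\widehat\gamma=\widehat\gamma_{\mathsf{pp}}+\widehat\gamma_{\mathsf{ac}}+\widehat\gamma_{\mathsf{sc}}$; purely singular continuous means $\widehat\gamma=\widehat\gamma_{\mathsf{sc}}$. *)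

theory Defs
  imports "HOL-Analysis.Analysis" "HOL-Library.Sublist"
begin

section \<open>Substitutions on compact alphabets\<close>

text \<open>The space of non-empty finite words, i.e. the disjoint union of the product spaces of
  \<open>n\<close>-letter words for \<open>n \<ge> 1\<close>. The sets \<open>listset Us\<close> are the open boxes; taking all factors to be
  \<open>UNIV\<close> shows that the set of words of each fixed length is open, hence clopen.\<close>

definition word_topology :: "'a::topological_space list topology" where
  "word_topology =
     topology_generated_by {listset Us |Us. Us \<noteq> [] \<and> (\<forall>U\<in>set Us. open U)}"

definition substitution :: "('a::topological_space \<Rightarrow> 'a list) \<Rightarrow> bool" where
  "substitution \<rho> \<longleftrightarrow>
     continuous_map euclidean word_topology \<rho> \<and> (\<exists>a. length (\<rho> a) \<ge> 2)"

definition constant_length :: "('a \<Rightarrow> 'a list) \<Rightarrow> nat \<Rightarrow> bool" where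
  "constant_length \<rho> L \<longleftrightarrow> (\<forall>a. length (\<rho> a) = L)"

definition subst_column :: "('a \<Rightarrow> 'a list) \<Rightarrow> nat \<Rightarrow> 'a \<Rightarrow> 'a" where
  "subst_column \<rho> j a = \<rho> a ! j"

text \<open>Abelian groups are written additively.\<close>

definition group_translation :: "('a::ab_group_add \<Rightarrow> 'a) \<Rightarrow> bool" where
  "group_translation f \<longleftrightarrow> (\<exists>\<beta>. \<forall>a. f a = \<beta> + a)"

definition subst_word :: "('a \<Rightarrow> 'a list) \<Rightarrow> 'a list \<Rightarrow> 'a list" where
  "subst_word \<rho> u = concat (map \<rho> u)"

text \<open>Since the words of each fixed length form a clopen set, the closure within that set coincides
  with the closure in the space of all words.\<close>

definition language :: "('a::topological_space \<Rightarrow> 'a list) \<Rightarrow> nat \<Rightarrow> 'a list set" where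
  "language \<rho> n =
     word_topology closure_of
       {u. length u = n \<and> (\<exists>a. \<exists>k\<ge>1. sublist u ((subst_word \<rho> ^^ k) [a]))}"

definition subshift :: "('a::topological_space \<Rightarrow> 'a list) \<Rightarrow> (int \<Rightarrow> 'a) set" where
  "subshift \<rho> = {w. \<forall>i j. i \<le> j \<longrightarrow> map w [i..j] \<in> language \<rho> (nat (j - i + 1))}"

definition shift :: "(int \<Rightarrow> 'a) \<Rightarrow> int \<Rightarrow> 'a" where
  "shift w n = w (n + 1)"

text \<open>For constant length \<open>L\<close>, concatenating the words \<open>\<rho> (w m)\<close> so that \<open>\<rho> (w 0)\<close> begins at
  position \<open>0\<close> puts \<open>\<rho> (w m)\<close> at the positions \<open>m * L, \<dots>, m * L + L - 1\<close>, for negative \<open>m\<close> as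
  well, as \<open>div\<close> rounds towards minus infinity.\<close>

definition subst_seq :: "nat \<Rightarrow> ('a \<Rightarrow> 'a list) \<Rightarrow> (int \<Rightarrow> 'a) \<Rightarrow> int \<Rightarrow> 'a" where
  "subst_seq L \<rho> w n = \<rho> (w (n div int L)) ! nat (n mod int L)"

definition pseudo_fixed_point ::
    "nat \<Rightarrow> ('a::topological_space \<Rightarrow> 'a list) \<Rightarrow> (int \<Rightarrow> 'a) \<Rightarrow> bool" where
  "pseudo_fixed_point L \<rho> w \<longleftrightarrow>
     w \<in> subshift \<rho> \<and> (\<exists>s<L. subst_seq L \<rho> w = (shift ^^ s) w)"

definition characters :: "('a::{topological_space, ab_group_add} \<Rightarrow> complex) set" where
  "characters =
     {chi. continuous_on UNIV chi \<and> (\<forall>a. chi a \<in> sphere 0 1) \<and> (\<forall>a b. chi (a + b) = chi a * chi b)}"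

section \<open>Diffraction\<close>

text \<open>The weighted Dirac comb with weight \<open>f m\<close> at each integer \<open>m\<close> is represented by
  \<open>f :: int \<Rightarrow> complex\<close>, and its autocorrelation measure by the coefficients below.\<close>

definition autocorrelation :: "(int \<Rightarrow> complex) \<Rightarrow> int \<Rightarrow> complex" where
  "autocorrelation f m =
     lim (\<lambda>N::nat. (\<Sum>j\<in>{- int N..int N}. f j * cnj (f (j + m))) / of_nat (2 * N + 1))"

text \<open>A positive measure on the circle is represented by its \<open>\<int>\<close>-periodisation on the real line.
  With the Fourier transform of the Dirac measure at \<open>m\<close> being \<open>t \<mapsto> exp (- 2 \<pi> i m t)\<close>, the
  transform of the pure point measure on \<open>\<int>\<close> with coefficients \<open>\<eta>\<close> is the periodic measure for
  which the integral of \<open>exp (2 \<pi> i m t)\<close> over a period is \<open>\<eta> m\<close>.\<close>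

definition is_fourier_transform :: "(int \<Rightarrow> complex) \<Rightarrow> real measure \<Rightarrow> bool" where
  "is_fourier_transform \<eta> \<mu> \<longleftrightarrow>
     sets \<mu> = sets borel \<and>
     (\<forall>B\<in>sets borel. emeasure \<mu> ((+) 1 ` B) = emeasure \<mu> B) \<and>
     emeasure \<mu> {0..<1} < \<infinity> \<and>
     (\<forall>m. (LINT t:{0..<1}|\<mu>. cis (2 * pi * of_int m * t)) = \<eta> m)"

definition diffraction :: "(int \<Rightarrow> complex) \<Rightarrow> real measure" where
  "diffraction f = (THE \<mu>. is_fourier_transform (autocorrelation f) \<mu>)"

section \<open>Lebesgue decomposition\<close>

definition pure_point :: "real measure \<Rightarrow> bool" where
  "pure_point \<mu> \<longleftrightarrow> (\<exists>C. countable C \<and> emeasure \<mu> (- C) = 0)"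

definition singular_continuous :: "real measure \<Rightarrow> bool" where
  "singular_continuous \<mu> \<longleftrightarrow>
     (\<forall>x. emeasure \<mu> {x} = 0) \<and> (\<exists>N\<in>null_sets lborel. emeasure \<mu> (- N) = 0)"

definition lebesgue_decomposition ::
    "real measure \<Rightarrow> real measure \<Rightarrow> real measure \<Rightarrow> real measure \<Rightarrow> bool" where
  "lebesgue_decomposition \<mu> pp ac sc \<longleftrightarrow>
     sets \<mu> = sets borel \<and> sets pp = sets borel \<and> sets ac = sets borel \<and> sets sc = sets borel \<and>
     (\<forall>B\<in>sets borel. emeasure \<mu> B = emeasure pp B + emeasure ac B + emeasure sc B) \<and>
     pure_point pp \<and> absolutely_continuous lborel ac \<and> singular_continuous sc"

definition purely_singular_continuous :: "real measure \<Rightarrow> bool" where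
  "purely_singular_continuous \<mu> \<longleftrightarrow>
     lebesgue_decomposition \<mu> (null_measure borel) (null_measure borel) \<mu>"

end

theory Submission
  imports Defs "HOL-Probability.Probability" "HOL-Library.Real_Mod"
begin

text \<open>Put \<open>f n = chi (w n)\<close>. The pseudo-fixed point equation reads \<open>f (n + s) = c (n mod L) * f (n div L)\<close>
  with unimodular \<open>c\<close>, so the autocorrelation \<open>\<eta>\<close> exists and is the unique fixed point, normalised by
  \<open>\<eta> 0 = 1\<close>, of the operator \<open>transfer\<close> below, which is contracting at \<open>1\<close> and \<open>-1\<close> and reduces
  \<open>\<bar>M\<bar>\<close> elsewhere. Consequently \<open>\<eta> (L ^ k * m) = \<eta> m\<close>, and \<open>\<eta> (L ^ k * m + r) \<longlonglongrightarrow> \<eta> m * \<eta> r\<close>: the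
  measure on the circle is mixing for multiplication by \<open>L\<close>. An atom at \<open>x\<close> would give
  \<open>exp (2 \<pi> i L ^ k x) \<longlonglongrightarrow> \<eta> 1\<close>, hence \<open>\<bar>\<eta> 1\<bar> = 1\<close>. Some \<open>m \<noteq> 0\<close> has \<open>\<eta> m \<noteq> 0\<close>, and the means
  of the functions \<open>exp (2 \<pi> i m L ^ k t)\<close> tend to \<open>\<eta> m\<close> in the mean square of the diffraction but to \<open>0\<close> in that
  of Lebesgue measure; so the two measures are mutually singular.\<close>

section \<open>Asymptotic fixed points of the transfer operator\<close>

text \<open>Unfolding the recursion \<open>k\<close> times shrinks the a priori bound
  \<open>B\<close> by \<open>q ^ k\<close> and collects the errors in a geometric series.
  \<open>p\<close> only has to tend to infinity, which covers both \<open>N div L\<close> and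
  \<open>k - 1\<close>.\<close>

lemma contraction_tendsto_zero:
  fixes b :: "nat \<Rightarrow> 'a::real_normed_field"
  assumes p: "filterlim p at_top sequentially"
    and bounded: "\<And>n. norm (b n) \<le> B" and l: "norm l < 1"
    and lim: "(\<lambda>n. b n - l * b (p n)) \<longlonglongrightarrow> 0"
  shows "b \<longlonglongrightarrow> 0"
proof (rule tendstoI)
  fix \<epsilon> :: real assume "\<epsilon> > 0"
  define q where "q = norm l"
  have q: "0 \<le> q" "q < 1" using l by (auto simp: q_def)
  \<comment> \<open>This makes the whole geometric series \<open>d / (1 - q)\<close> equal to half
    of \<open>\<epsilon>\<close>.\<close>
  define d where "d = \<epsilon> * (1 - q) / 2"
  have d: "d > 0" using \<open>\<epsilon> > 0\<close> q by (simp add: d_def)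
  have "\<forall>\<^sub>F n in sequentially. norm (b n) \<le> q ^ k * B + d / (1 - q)" for k
  proof (induction k)
    case 0
    show ?case using bounded d q by (auto intro!: always_eventually add_increasing2)
  next
    case (Suc k)
    have "\<forall>\<^sub>F n in sequentially. norm (b (p n)) \<le> q ^ k * B + d / (1 - q)"
      using Suc p by (rule eventually_compose_filterlim)
    moreover have "\<forall>\<^sub>F n in sequentially. norm (b n - l * b (p n)) < d"
      using tendstoD[OF lim d] by simp
    ultimately show ?case
    proof eventually_elim
      case (elim n)
      have "norm (b n) \<le> norm (b n - l * b (p n)) + q * norm (b (p n))"
        using norm_triangle_sub[of "b n" "l * b (p n)"] by (simp add: q_def norm_mult)
      also have "\<dots> \<le> d + q * (q ^ k * B + d / (1 - q))"
        using elim q by (intro add_mono mult_left_mono) auto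
      also have "\<dots> = q ^ Suc k * B + d / (1 - q)"
        using q by (simp add: field_simps)
      finally show ?case .
    qed
  qed
  moreover have "(\<lambda>k. q ^ k * B + d / (1 - q)) \<longlonglongrightarrow> 0 * B + d / (1 - q)"
    using q by (intro tendsto_intros LIMSEQ_power_zero) auto
  moreover have "d / (1 - q) = \<epsilon> / 2"
    using q by (simp add: d_def field_simps)
  then have "0 * B + d / (1 - q) < \<epsilon>"
    using \<open>\<epsilon> > 0\<close> by simp
  ultimately obtain k where "q ^ k * B + d / (1 - q) < \<epsilon>"
    and "\<forall>\<^sub>F n in sequentially. norm (b n) \<le> q ^ k * B + d / (1 - q)"
    by (metis (no_types, lifting) order_tendstoD(2) eventually_happens sequentially_bot)
  then show "\<forall>\<^sub>F n in sequentially. dist (b n) 0 < \<epsilon>"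
    by (auto elim!: eventually_mono)
qed

text \<open>\<open>k / (1 - l)\<close> solves \<open>x = k + l * x\<close>; subtracting it leaves
  the homogeneous recursion.\<close>

lemma contraction_tendsto:
  fixes b :: "nat \<Rightarrow> 'a::real_normed_field"
  assumes p: "filterlim p at_top sequentially"
    and bounded: "\<And>n. norm (b n) \<le> B" and l: "norm l < 1"
    and lim: "(\<lambda>n. b n - l * b (p n)) \<longlonglongrightarrow> k"
  shows "b \<longlonglongrightarrow> k / (1 - l)"
proof -
  define a where "a = k / (1 - l)"
  have "l \<noteq> 1" using l by auto
  then have "a * (1 - l) = k" by (simp add: a_def)
  then have a: "k = a - l * a" by (simp add: algebra_simps)
  have "(\<lambda>n. b n - a) \<longlonglongrightarrow> 0"
  proof (rule contraction_tendsto_zero[OF p _ l])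
    show "norm (b n - a) \<le> B + norm a" for n
      using norm_triangle_ineq4[of "b n" a] bounded[of n] by linarith
    have "(\<lambda>n. (b n - l * b (p n)) - k) \<longlonglongrightarrow> k - k"
      by (intro tendsto_intros lim)
    then show "(\<lambda>n. (b n - a) - l * (b (p n) - a)) \<longlonglongrightarrow> 0"
      by (simp add: a algebra_simps)
  qed
  then show ?thesis unfolding a_def by (simp add: LIM_zero_iff)
qed

section \<open>Integer division and descent in absolute value\<close>

lemma le_div_iff_mult_le:
  fixes L :: int
  assumes "0 < L"
  shows "a \<le> n div L \<longleftrightarrow> a * L \<le> n"
proof
  have n: "n = n div L * L + n mod L" "0 \<le> n mod L" "n mod L < L" using assms by auto
  show "a * L \<le> n" if "a \<le> n div L"
    using mult_right_mono[OF that, of L] assms n by linarith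
  show "a \<le> n div L" if "a * L \<le> n"
  proof (rule ccontr)
    assume "\<not> a \<le> n div L"
    then have "(n div L + 1) * L \<le> a * L" using assms by (intro mult_right_mono) auto
    then have "n div L * L + L \<le> a * L" by (simp add: algebra_simps)
    then show False using that n by linarith
  qed
qed

text \<open>This drives the inductions on \<open>\<bar>M\<bar>\<close>. It fails at \<open>1\<close>
  and \<open>-1\<close>, where \<open>(L - 1 + 1) div L = 1\<close> and
  \<open>(0 - 1) div L = -1\<close>.\<close>

lemma abs_div_less:
  fixes M j L :: int
  assumes "2 \<le> L" "0 \<le> j" "j < L" "2 \<le> \<bar>M\<bar>"
  shows "\<bar>(j + M) div L\<bar> < \<bar>M\<bar>"
proof (cases "M > 0")
  case True
  \<comment> \<open>As \<open>j \<le> L - 1 < (L - 1) * M\<close>, adding \<open>M\<close> yields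
    \<open>j + M < L * M\<close>.\<close>
  have "(L - 1) * 1 < (L - 1) * M"
    using assms True by (intro mult_strict_left_mono) auto
  then have "j + M < M * L" using assms by (simp add: algebra_simps)
  then have "(j + M) div L < M" using assms le_div_iff_mult_le[of L M "j + M"] by simp
  moreover have "0 \<le> (j + M) div L" using True assms by (simp add: pos_imp_zdiv_nonneg_iff)
  ultimately show ?thesis by simp
next
  case False
  have "(L - 1) * 2 \<le> (L - 1) * (- M)"
    using assms False by (intro mult_left_mono) auto
  then have "(M + 1) * L \<le> j + M" using assms by (simp add: algebra_simps)
  then have "M + 1 \<le> (j + M) div L" using assms le_div_iff_mult_le[of L "M + 1" "j + M"] by simp
  moreover have "(j + M) div L \<le> j div L" using False assms by (intro zdiv_mono1) auto
  then have "(j + M) div L \<le> 0" using assms by simp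
  ultimately show ?thesis using False by simp
qed

section \<open>The transfer operator and its fixed points\<close>

locale block_phases =
  fixes L :: int and c :: "int \<Rightarrow> complex"
  assumes L_ge_2: "2 \<le> L" and norm_c: "\<And>j. 0 \<le> j \<Longrightarrow> j < L \<Longrightarrow> norm (c j) = 1"
begin

text \<open>The renormalisation of correlations: a position with residue \<open>j\<close> in its
  block and the position at distance \<open>M\<close> from it lie in blocks at distance
  \<open>(j + M) div L\<close> and carry the phases \<open>c j\<close> and
  \<open>c ((j + M) mod L)\<close>; the residues are averaged over.\<close>

definition transfer :: "(int \<Rightarrow> complex) \<Rightarrow> int \<Rightarrow> complex" where
  "transfer h M =
     (\<Sum>j\<in>{0..<L}. c j * cnj (c ((j + M) mod L)) * h ((j + M) div L)) / of_int L"

lemma c_mult_cnj: "0 \<le> j \<Longrightarrow> j < L \<Longrightarrow> c j * cnj (c j) = 1"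
  using norm_c[of j] by (simp add: complex_norm_square[symmetric])

lemma transfer_diff_scale:
  "transfer (\<lambda>M. g M - a * h M) M = transfer g M - a * transfer h M"
  by (simp add: transfer_def algebra_simps sum_subtractf sum_distrib_left diff_divide_distrib)

lemma transfer_scale: "transfer (\<lambda>M. a * h M) M = a * transfer h M"
  by (simp add: transfer_def sum_distrib_left algebra_simps)

text \<open>A distance divisible by \<open>L\<close> preserves residues, so the phases cancel. This
  is the source of the invariance under multiplication by \<open>L\<close>.\<close>

lemma transfer_mult_L: "transfer h (L * M) = h M"
proof -
  have "c j * cnj (c ((j + L * M) mod L)) * h ((j + L * M) div L) = h M" if "j \<in> {0..<L}" for j
    using that L_ge_2 c_mult_cnj[of j] by simp
  then have "transfer h (L * M) = (\<Sum>j\<in>{0..<L}. h M) / of_int L"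
    unfolding transfer_def by (metis (no_types, lifting) sum.cong)
  then show ?thesis using L_ge_2 by simp
qed

text \<open>Only one residue crosses a block boundary; all others stay in their block and see
  \<open>h 0\<close>. Hence \<open>l\<close> consists of a single term, of modulus
  \<open>1 / L\<close>.\<close>

lemma transfer_unit:
  assumes "\<bar>s\<bar> = 1"
  obtains k l where "norm l < 1" "\<And>h. transfer h s = k * h 0 + l * h s"
proof -
  \<comment> \<open>Adding \<open>1\<close> carries at the last residue, adding \<open>-1\<close>
    borrows at residue \<open>0\<close>.\<close>
  define i where "i = (if s = 1 then L - 1 else 0)"
  have i: "i \<in> {0..<L}" using L_ge_2 by (auto simp: i_def)
  have div_i: "(i + s) div L = s"
    using assms L_ge_2 by (auto simp: i_def abs_if div_eq_minus1 split: if_splits)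
  have div_other: "(j + s) div L = 0" if "j \<in> {0..<L} - {i}" for j
    using that assms by (intro div_pos_pos_trivial) (auto simp: i_def split: if_splits)
  define d where "d j = c j * cnj (c ((j + s) mod L)) / of_int L" for j
  have "norm (d i) = 1 / of_int L"
    using i L_ge_2 by (simp add: d_def norm_mult norm_divide norm_c)
  then have "norm (d i) < 1" using L_ge_2 by simp
  moreover have "transfer h s = (\<Sum>j\<in>{0..<L} - {i}. d j) * h 0 + d i * h s" for h
  proof -
    have "transfer h s = (\<Sum>j\<in>{0..<L}. d j * h ((j + s) div L))"
      by (simp add: transfer_def d_def sum_divide_distrib)
    also have "\<dots> = d i * h s + (\<Sum>j\<in>{0..<L} - {i}. d j * h ((j + s) div L))"
      using i div_i by (simp add: sum.remove)
    also have "(\<Sum>j\<in>{0..<L} - {i}. d j * h ((j + s) div L)) = (\<Sum>j\<in>{0..<L} - {i}. d j) * h 0"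
      unfolding sum_distrib_right using div_other by (intro sum.cong) auto
    finally show ?thesis by simp
  qed
  ultimately show thesis by (rule that)
qed

lemma tendsto_transfer:
  assumes "\<And>j. 0 \<le> j \<Longrightarrow> j < L \<Longrightarrow> (\<lambda>n. E n ((j + M) div L)) \<longlonglongrightarrow> h ((j + M) div L)"
  shows "(\<lambda>n. transfer (E n) M) \<longlonglongrightarrow> transfer h M"
  unfolding transfer_def using L_ge_2 assms by (intro tendsto_intros) auto

text \<open>The difference of both sides is a fixed point vanishing at \<open>0\<close>. At
  \<open>1\<close> and \<open>-1\<close> it satisfies \<open>d = l * d\<close> with
  \<open>norm l < 1\<close>; every other value is a combination of values at smaller
  distances.\<close>

lemma transfer_fixpoint_unique:
  assumes g: "\<And>M. transfer g M = g M" and h: "\<And>M. transfer h M = h M" and "g 0 = a * h 0"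
  shows "g M = a * h M"
proof -
  define d where "d M = g M - a * h M" for M
  have d: "d M = transfer d M" for M
    unfolding d_def using transfer_diff_scale g h by simp
  have "d M = 0"
  proof (induction "nat \<bar>M\<bar>" arbitrary: M rule: less_induct)
    case less
    consider "M = 0" | "\<bar>M\<bar> = 1" | "2 \<le> \<bar>M\<bar>" by linarith
    then show ?case
    proof cases
      case 1
      then show ?thesis using assms by (simp add: d_def)
    next
      case 2
      obtain k l where kl: "norm l < 1" "\<And>h. transfer h M = k * h 0 + l * h M"
        using transfer_unit[OF 2] by blast
      have "d M = l * d M" using kl(2)[of d] d[of M] assms(3) by (simp add: d_def)
      then show ?thesis using kl(1) by auto
    next
      case 3
      have "d ((j + M) div L) = 0" if "0 \<le> j" "j < L" for j
        using abs_div_less[OF L_ge_2 that 3] by (intro less) auto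
      then show ?thesis by (subst d) (simp add: transfer_def)
    qed
  qed
  then show ?thesis by (simp add: d_def)
qed

text \<open>The same descent with limits in place of values: contraction at \<open>1\<close> and
  \<open>-1\<close>, limits of finite sums elsewhere. It serves for the correlation means, with
  \<open>p N = N div L\<close>, and for mixing, with \<open>p k = k - 1\<close>.\<close>

lemma asymptotic_transfer_fixpoint:
  assumes p: "filterlim p at_top sequentially"
    and bounded: "\<And>n M. norm (E n M) \<le> B"
    and rec: "\<And>M. (\<lambda>n. E n M - transfer (E (p n)) M) \<longlonglongrightarrow> 0"
    and zero: "(\<lambda>n. E n 0) \<longlonglongrightarrow> a"
  obtains h where "\<And>M. (\<lambda>n. E n M) \<longlonglongrightarrow> h M" "\<And>M. transfer h M = h M" "h 0 = a"
proof -
  have "convergent (\<lambda>n. E n M)" for M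
  proof (induction "nat \<bar>M\<bar>" arbitrary: M rule: less_induct)
    case less
    consider "M = 0" | "\<bar>M\<bar> = 1" | "2 \<le> \<bar>M\<bar>" by linarith
    then show ?case
    proof cases
      case 1
      then show ?thesis using zero by (auto simp: convergent_def)
    next
      case 2
      obtain k l where kl: "norm l < 1" "\<And>h. transfer h M = k * h 0 + l * h M"
        using transfer_unit[OF 2] by blast
      have "(\<lambda>n. (E n M - transfer (E (p n)) M) + k * E (p n) 0) \<longlonglongrightarrow> 0 + k * a"
        by (intro tendsto_intros rec filterlim_compose[OF zero p])
      then have "(\<lambda>n. E n M - l * E (p n) M) \<longlonglongrightarrow> k * a"
        by (simp add: kl(2) algebra_simps)
      from contraction_tendsto[OF p bounded kl(1) this] show ?thesis by (auto simp: convergent_def)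
    next
      case 3
      have conv: "(\<lambda>n. E (p n) ((j + M) div L)) \<longlonglongrightarrow> lim (\<lambda>n. E n ((j + M) div L))"
        if "0 \<le> j" "j < L" for j
        using abs_div_less[OF L_ge_2 that 3]
        by (intro filterlim_compose[OF _ p] less[THEN convergent_LIMSEQ_iff[THEN iffD1]]) auto
      have "(\<lambda>n. (E n M - transfer (E (p n)) M) + transfer (E (p n)) M)
        \<longlonglongrightarrow> 0 + transfer (\<lambda>M. lim (\<lambda>n. E n M)) M"
        by (intro tendsto_add rec tendsto_transfer conv)
      then show ?thesis by (auto simp: convergent_def)
    qed
  qed
  then obtain h where h: "\<And>M. (\<lambda>n. E n M) \<longlonglongrightarrow> h M"
    unfolding convergent_def by metis
  moreover have "transfer h M = h M" for M
  proof -
    have "(\<lambda>n. E n M - transfer (E (p n)) M) \<longlonglongrightarrow> h M - transfer h M"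
      by (intro tendsto_diff tendsto_transfer h filterlim_compose[OF h p])
    from LIMSEQ_unique[OF this rec] show ?thesis by simp
  qed
  moreover have "h 0 = a" using LIMSEQ_unique[OF h zero] .
  ultimately show thesis by (rule that)
qed

lemma transfer_fixpoint_mult_power:
  assumes "\<And>M. transfer h M = h M"
  shows "h (L ^ k * M) = h M"
proof (induction k)
  case (Suc k)
  then show ?case using transfer_mult_L[of h "L ^ k * M"] assms by (simp add: mult.assoc)
qed simp

text \<open>For fixed \<open>m\<close> the functions \<open>E k\<close> of \<open>r\<close> satisfy
  \<open>E k = transfer (E (k - 1))\<close> for \<open>k > 0\<close>, because adding a multiple of
  \<open>L\<close> keeps residues and only translates quotients. Their limit is a fixed point with
  value \<open>h m\<close> at \<open>0\<close>, hence by uniqueness the multiple of \<open>h\<close>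
  by \<open>h m\<close>.\<close>

lemma transfer_fixpoint_mixing:
  assumes h: "\<And>M. transfer h M = h M" and "h 0 = 1" and bounded: "\<And>M. norm (h M) \<le> B"
  shows "(\<lambda>k. h (L ^ k * m + r)) \<longlonglongrightarrow> h m * h r"
proof -
  define E where "E k r = h (L ^ k * m + r)" for k :: nat and r
  have rec: "transfer (E (k - 1)) r = E k r" if "k > 0" for k r
  proof -
    have shift: "j + (L ^ k * m + r) = L ^ (k - 1) * m * L + (j + r)" for j
      using that power_Suc[of L "k - 1"] by (simp add: algebra_simps)
    have *: "(j + (L ^ k * m + r)) div L = L ^ (k - 1) * m + (j + r) div L"
      "(j + (L ^ k * m + r)) mod L = (j + r) mod L" for j
      unfolding shift using L_ge_2 by simp_all
    have "E k r = transfer h (L ^ k * m + r)" by (simp add: E_def h)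
    also have "\<dots> = transfer (E (k - 1)) r"
      by (simp add: transfer_def E_def *)
    finally show ?thesis by simp
  qed
  have p: "filterlim (\<lambda>k::nat. k - 1) at_top sequentially"
    by (rule filterlim_minus_const_nat_at_top)
  have "(\<lambda>k. E k M - transfer (E (k - 1)) M) \<longlonglongrightarrow> 0" for M
  proof (rule tendsto_eventually)
    show "\<forall>\<^sub>F k in sequentially. E k M - transfer (E (k - 1)) M = 0"
      using eventually_gt_at_top[of 0]
    proof (rule eventually_mono)
      show "E k M - transfer (E (k - 1)) M = 0" if "0 < k" for k
        unfolding rec[OF that] by simp
    qed
  qed
  moreover have "(\<lambda>k. E k 0) \<longlonglongrightarrow> h m"
    using transfer_fixpoint_mult_power[OF h] by (simp add: E_def)
  moreover have "norm (E k M) \<le> B" for k M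
    by (simp add: E_def bounded)
  ultimately obtain g where
    g: "\<And>M. (\<lambda>k. E k M) \<longlonglongrightarrow> g M" "\<And>M. transfer g M = g M" "g 0 = h m"
    using asymptotic_transfer_fixpoint[OF p, of E B "h m"] by blast
  have "g r = h m * h r"
    by (rule transfer_fixpoint_unique[of g h "h m" r]) (simp_all only: g h \<open>h 0 = 1\<close> mult_1_right)
  then show ?thesis using g(1)[of r] by (simp add: E_def)
qed

text \<open>If the coefficient at \<open>1\<close> vanishes, then only the term \<open>j = 0\<close> survives at \<open>L - 1\<close>.\<close>

lemma transfer_fixpoint_nonzero:
  assumes h: "\<And>M. transfer h M = h M" and "h 0 = 1"
  obtains m where "m \<noteq> 0" "h m \<noteq> 0"
proof (cases "h 1 = 0")
  case True
  \<comment> \<open>Here \<open>j + L - 1\<close> lies between \<open>L\<close> and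
    \<open>2 * L - 2\<close>: only residue \<open>0\<close> avoids a carry.\<close>
  have "(j + (L - 1)) div L = 1" if "j \<in> {0..<L} - {0}" for j
    using that div_pos_pos_trivial[of "j - 1" L] div_add_self2[of L "j - 1"] by (simp add: algebra_simps)
  then have "(\<Sum>j\<in>{0..<L} - {0}. c j * cnj (c ((j + (L - 1)) mod L)) * h ((j + (L - 1)) div L)) = 0"
    using True by (intro sum.neutral) simp
  moreover have "(L - 1) div L = 0" "(L - 1) mod L = L - 1"
    using L_ge_2 by (simp_all add: div_pos_pos_trivial mod_pos_pos_trivial del: minus_mod_self1 minus_mod_self2)
  ultimately have "h (L - 1) = c 0 * cnj (c (L - 1)) / of_int L"
    using L_ge_2 \<open>h 0 = 1\<close> h[of "L - 1", symmetric]
    by (simp add: transfer_def sum.remove[where x = 0] del: minus_mod_self2 minus_mod_self1)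
  moreover have "c 0 \<noteq> 0" "c (L - 1) \<noteq> 0"
    using norm_c[of 0] norm_c[of "L - 1"] L_ge_2 by auto
  ultimately show thesis using L_ge_2 by (intro that[of "L - 1"]) auto
qed (use that[of 1] in auto)

end

section \<open>Autocorrelation of block sequences\<close>

definition correlation_sum :: "(int \<Rightarrow> complex) \<Rightarrow> nat \<Rightarrow> int \<Rightarrow> complex" where
  "correlation_sum f N M = (\<Sum>j\<in>{- int N..int N}. f j * cnj (f (j + M)))"

lemma norm_correlation_sum_le:
  assumes "\<And>n. norm (f n) = 1"
  shows "norm (correlation_sum f N M) \<le> 2 * real N + 1"
  unfolding correlation_sum_def
  by (rule order_trans[OF norm_sum]) (simp add: norm_mult assms)

text \<open>Common terms cancel; this prices the replacement of one window by another.\<close>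

lemma norm_sum_diff_le_card:
  fixes g :: "'a \<Rightarrow> 'b::real_normed_vector"
  assumes "finite A" "finite B" "\<And>x. norm (g x) \<le> 1"
  shows "norm (sum g A - sum g B) \<le> real (card (A - B)) + real (card (B - A))"
proof -
  have "sum g A = sum g (A - B) + sum g (A \<inter> B)" "sum g B = sum g (B - A) + sum g (A \<inter> B)"
    using assms by (metis add.commute sum.Int_Diff, metis add.commute inf_commute sum.Int_Diff)
  then have "norm (sum g A - sum g B) = norm (sum g (A - B) - sum g (B - A))" by simp
  also have "\<dots> \<le> norm (sum g (A - B)) + norm (sum g (B - A))" by (rule norm_triangle_ineq4)
  also have "\<dots> \<le> real (card (A - B)) + real (card (B - A))"
    using assms sum_norm_le[of "A - B" g "\<lambda>_. 1"] sum_norm_le[of "B - A" g "\<lambda>_. 1"]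
    by (intro add_mono) auto
  finally show ?thesis .
qed

lemma sum_blocks:
  fixes g :: "int \<Rightarrow> 'a::comm_monoid_add" and L s :: int
  assumes "0 < L"
  shows "(\<Sum>q\<in>{a..b}. \<Sum>j\<in>{0..<L}. g (L * q + j + s)) = sum g {L * a + s..<L * (b + 1) + s}"
proof -
  have "(\<Sum>q\<in>{a..b}. \<Sum>j\<in>{0..<L}. g (L * q + j + s))
      = (\<Sum>(q, j)\<in>{a..b} \<times> {0..<L}. g (L * q + j + s))"
    by (simp add: sum.cartesian_product)
  also have "\<dots> = sum g {L * a + s..<L * (b + 1) + s}"
  proof (rule sum.reindex_bij_witness[where j = "\<lambda>(q, j). L * q + j + s"
        and i = "\<lambda>n. ((n - s) div L, (n - s) mod L)"])
    fix n assume n: "n \<in> {L * a + s..<L * (b + 1) + s}"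
    have "a \<le> (n - s) div L" "(n - s) div L < b + 1"
      using n assms le_div_iff_mult_le[of L a "n - s"]
        le_div_iff_mult_le[of L "b + 1" "n - s"] by (auto simp: mult.commute)
    then show "((n - s) div L, (n - s) mod L) \<in> {a..b} \<times> {0..<L}" using assms by simp
  next
    fix p assume "p \<in> {a..b} \<times> {0..<L}"
    then obtain q j where p: "p = (q, j)" "a \<le> q" "q \<le> b" "0 \<le> j" "j < L" by auto
    have "L * a \<le> L * q" "L * q \<le> L * b" using p assms by (simp_all add: mult_left_mono)
    then have "L * a + s \<le> L * q + j + s" "L * q + j + s < L * b + L + s"
      using p by linarith+
    then show "(case p of (q, j) \<Rightarrow> L * q + j + s) \<in> {L * a + s..<L * (b + 1) + s}"
      using p by (simp add: distrib_left)
  qed auto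
  finally show ?thesis .
qed

lemma window_nonzero [simp]: "1 + 2 * of_nat N \<noteq> (0 :: 'a::semiring_char_0)"
proof -
  have "of_nat (1 + 2 * N) \<noteq> (0 :: 'a)" by (simp only: of_nat_eq_0_iff)
  then show ?thesis by simp
qed

lemma lim_const_over_window: "(\<lambda>n. a / (2 * real n + 1)) \<longlonglongrightarrow> 0"
  by real_asymp

text \<open>A pseudo-fixed point seen through a character: \<open>s\<close> is the shift in its
  equation, \<open>c j\<close> the phase contributed by column \<open>j\<close>.\<close>

locale block_sequence = block_phases +
  fixes s :: int and f :: "int \<Rightarrow> complex"
  assumes s: "0 \<le> s" "s < L"
    and norm_f: "\<And>n. norm (f n) = 1"
    and f_shift: "\<And>n. f (n + s) = c (n mod L) * f (n div L)"
begin

lemma mult_transfer: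
  "of_int L * transfer h M = (\<Sum>j\<in>{0..<L}. c j * cnj (c ((j + M) mod L)) * h ((j + M) div L))"
  using L_ge_2 by (simp add: transfer_def)

text \<open>Over whole blocks the correlation sum is exactly the rescaled transfer. The error counts
  the positions in which the blocks numbered \<open>-K\<close> to \<open>K\<close>, displaced by
  \<open>s\<close>, differ from the window \<open>-N\<close> to \<open>N\<close>.\<close>

lemma correlation_sum_blocks:
  "norm (correlation_sum f N M -
      of_int L * transfer (correlation_sum f (N div nat L)) M) \<le> 4 * of_int L"
proof -
  define K where "K = int (N div nat L)"
  define i where "i = int N mod L"
  have N: "int N = L * K + i" "0 \<le> i" "i < L"
    using L_ge_2 by (auto simp: K_def i_def zdiv_int)
  define g where "g n = f n * cnj (f (n + M))" for n
  have g: "g (L * q + j + s) = c j * cnj (c ((j + M) mod L)) *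
      (f q * cnj (f (q + (j + M) div L)))" if "j \<in> {0..<L}" for q j
  proof -
    have "f (L * q + j + s) = c j * f q"
      using f_shift[of "L * q + j"] that by simp
    moreover have "f (L * q + j + s + M) = c ((j + M) mod L) * f (q + (j + M) div L)"
    proof -
      have "f (L * q + j + s + M) = f ((q * L + (j + M)) + s)" by (simp add: algebra_simps)
      also have "\<dots> = c ((j + M) mod L) * f (q + (j + M) div L)"
        using f_shift[of "q * L + (j + M)"] L_ge_2 by simp
      finally show ?thesis .
    qed
    ultimately show ?thesis by (simp add: g_def algebra_simps)
  qed
  have "of_int L * transfer (correlation_sum f (N div nat L)) M
      = (\<Sum>j\<in>{0..<L}. \<Sum>q\<in>{-K..K}. g (L * q + j + s))"
    unfolding mult_transfer by (simp add: correlation_sum_def sum_distrib_left K_def g)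
  also have "\<dots> = sum g {L * (- K) + s..<L * (K + 1) + s}"
    using L_ge_2 by (subst sum.swap) (rule sum_blocks, simp)
  finally have T: "of_int L * transfer (correlation_sum f (N div nat L)) M
      = sum g {L * (- K) + s..<L * (K + 1) + s}" .
  define A where "A = {- int N..int N}"
  define B where "B = {L * (- K) + s..<L * (K + 1) + s}"
  \<comment> \<open>The blocks start at \<open>- N + i + s\<close> and end at
    \<open>N - i + L + s - 1\<close>. As \<open>i\<close> and \<open>s\<close> lie between
    \<open>0\<close> and \<open>L - 1\<close>, neither end is to the left of that of the window, and
    both are within \<open>2 * L\<close> of it.\<close>
  have "A - B \<subseteq> {- int N..<- int N + 2 * L}" "B - A \<subseteq> {int N<..int N + 2 * L}"
    unfolding A_def B_def using N s by (auto simp: algebra_simps)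
  then have "card (A - B) \<le> nat (2 * L)" "card (B - A) \<le> nat (2 * L)"
    using card_mono[of "{- int N..<- int N + 2 * L}" "A - B"]
      card_mono[of "{int N<..int N + 2 * L}" "B - A"] by auto
  then have "real (card (A - B)) + real (card (B - A)) \<le> 4 * of_int L"
    using L_ge_2 by linarith
  moreover have "norm (sum g A - sum g B) \<le> real (card (A - B)) + real (card (B - A))"
    by (rule norm_sum_diff_le_card) (auto simp: A_def B_def g_def norm_mult norm_f)
  ultimately show ?thesis
    unfolding T by (simp add: correlation_sum_def g_def[symmetric] A_def B_def)
qed

definition correlation_mean :: "nat \<Rightarrow> int \<Rightarrow> complex" where
  "correlation_mean N M = correlation_sum f N M / of_nat (2 * N + 1)"

lemma norm_correlation_mean: "norm (correlation_mean N M) \<le> 1"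
proof -
  have "norm (of_nat (2 * N + 1) :: complex) = 2 * real N + 1"
    by (simp only: norm_of_nat)
  then show ?thesis
    using norm_correlation_sum_le[OF norm_f, where N = N and M = M]
    by (simp only: correlation_mean_def norm_divide norm_of_nat of_nat_add of_nat_mult of_nat_numeral of_nat_1 divide_le_eq_1) simp
qed

lemma norm_transfer_le:
  assumes "\<And>M. norm (h M) \<le> B" shows "norm (transfer h M) \<le> B"
proof -
  have "norm (\<Sum>j\<in>{0..<L}. c j * cnj (c ((j + M) mod L)) * h ((j + M) div L)) \<le> (\<Sum>j\<in>{0..<L}. B)"
    using assms L_ge_2 by (intro sum_norm_le) (simp add: norm_mult norm_c)
  then show ?thesis using L_ge_2 by (simp add: transfer_def norm_divide field_simps)
qed

text \<open>Two bounded errors are divided by \<open>2 * N + 1\<close>: \<open>4 * L\<close> from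
  the boundary, and \<open>L\<close> from normalising by \<open>L * (2 * K + 1)\<close>
  instead.\<close>

lemma correlation_mean_transfer:
  "(\<lambda>N. correlation_mean N M - transfer (correlation_mean (N div nat L)) M) \<longlonglongrightarrow> 0"
proof (rule Lim_null_comparison[OF _ lim_const_over_window[of "5 * of_int L"]], rule always_eventually, rule allI)
  fix N
  define K where "K = N div nat L"
  define W where "W = 2 * real N + 1"
  define V where "V = 2 * real K + 1"
  have W: "W > 0" "V > 0" by (simp_all add: W_def V_def)
  let ?S = "transfer (correlation_sum f K) M" and ?m = "transfer (correlation_mean K) M"
  have mean: "correlation_sum f n m = of_real (2 * real n + 1) * correlation_mean n m" for n m
    by (simp add: correlation_mean_def add.commute[of _ 1])
  then have "correlation_sum f K = (\<lambda>M. of_real V * correlation_mean K M)"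
    by (simp add: V_def fun_eq_iff)
  then have S: "?S = of_real V * ?m" by (simp add: transfer_scale)
  have "int N = L * int K + int N mod L" "0 \<le> int N mod L" "int N mod L < L"
    using L_ge_2 by (auto simp: K_def zdiv_int)
  then have "real_of_int (int N) = real_of_int (L * int K + int N mod L)" by simp
  then have "real N = of_int L * real K + of_int (int N mod L)" by simp
  moreover have "0 \<le> real_of_int (int N mod L)" "real_of_int (int N mod L) + 1 \<le> of_int L"
    using \<open>int N mod L < L\<close> \<open>0 \<le> int N mod L\<close> by linarith+
  \<comment> \<open>With \<open>i = N mod L\<close>, the difference is
    \<open>L - 2 * i - 1\<close>.\<close>
  ultimately have d: "\<bar>of_int L * V - W\<bar> \<le> of_int L"
    using L_ge_2 by (auto simp: V_def W_def abs_le_iff algebra_simps)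
  have "of_real W * (correlation_mean N M - ?m)
      = (correlation_sum f N M - of_int L * ?S) + of_real (of_int L * V - W) * ?m"
    by (simp only: S mean W_def[symmetric]) (simp add: algebra_simps)
  also have "norm \<dots> \<le> 4 * of_int L + of_int L * 1"
  proof (rule norm_triangle_mono)
    show "norm (correlation_sum f N M - of_int L * ?S) \<le> 4 * of_int L"
      unfolding K_def by (rule correlation_sum_blocks)
    show "norm (of_real (of_int L * V - W) * ?m) \<le> of_int L * 1"
      unfolding norm_mult norm_of_real
      using d L_ge_2 by (intro mult_mono norm_transfer_le norm_correlation_mean) auto
  qed
  finally have "W * norm (correlation_mean N M - ?m) \<le> 5 * of_int L"
    using W by (simp add: norm_mult)
  then show "norm (correlation_mean N M - transfer (correlation_mean (N div nat L)) M)
      \<le> 5 * of_int L / (2 * real N + 1)"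
    using W unfolding W_def[symmetric] K_def[symmetric] by (simp add: pos_le_divide_eq mult.commute)
qed

text \<open>Since \<open>autocorrelation\<close> is defined through \<open>lim\<close>, convergence
  has to come first. The means are an asymptotic fixed point along \<open>N div L\<close>, with
  value \<open>1\<close> at distance \<open>0\<close>.\<close>

lemma
  shows correlation_mean_tendsto: "(\<lambda>N. correlation_mean N M) \<longlonglongrightarrow> autocorrelation f M"
    and transfer_autocorrelation: "transfer (autocorrelation f) M = autocorrelation f M"
    and autocorrelation_zero: "autocorrelation f 0 = 1"
    and norm_autocorrelation: "norm (autocorrelation f M) \<le> 1"
proof -
  have "f j * cnj (f j) = 1" for j
    using norm_f[of j] by (simp add: complex_norm_square[symmetric])
  moreover have "of_nat (2 * N + 1) = (of_int (2 * int N + 1) :: complex)" for N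
    by simp
  ultimately have "correlation_mean N 0 = 1" for N
    by (simp add: correlation_mean_def correlation_sum_def add.commute[of _ 1])
  then have 0: "(\<lambda>N. correlation_mean N 0) \<longlonglongrightarrow> 1" by simp
  have "filterlim (\<lambda>N. N div nat L) at_top sequentially"
    using L_ge_2 by (intro filterlim_at_top_div_const_nat) auto
  from asymptotic_transfer_fixpoint[OF this norm_correlation_mean correlation_mean_transfer 0]
  obtain h where h: "\<And>M. (\<lambda>N. correlation_mean N M) \<longlonglongrightarrow> h M"
    "\<And>M. transfer h M = h M" "h 0 = 1" by blast
  have "autocorrelation f = h"
    using h(1)[THEN limI]
    by (simp add: fun_eq_iff autocorrelation_def correlation_mean_def correlation_sum_def)
  then show "(\<lambda>N. correlation_mean N M) \<longlonglongrightarrow> autocorrelation f M"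
    "transfer (autocorrelation f) M = autocorrelation f M"
    "autocorrelation f 0 = 1" "norm (autocorrelation f M) \<le> 1"
    using h LIMSEQ_le_const2[OF tendsto_norm[OF h(1)]] norm_correlation_mean by auto
qed

end

section \<open>Trigonometric moments\<close>

definition wave :: "int \<Rightarrow> real \<Rightarrow> complex" where
  "wave m t = cis (2 * pi * of_int m * t)"

lemma wave_0 [simp]: "wave 0 t = 1"
  by (simp add: wave_def)

lemma wave_add: "wave (m + n) t = wave m t * wave n t"
  by (simp add: wave_def cis_mult algebra_simps)

lemma cnj_wave [simp]: "cnj (wave m t) = wave (- m) t"
  by (simp add: wave_def cis_cnj)

lemma norm_wave [simp]: "norm (wave m t) = 1"
  by (simp add: wave_def)

lemma wave_power: "wave (int k * m) t = wave m t ^ k"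
  by (simp add: wave_def Complex.DeMoivre mult_ac)

lemma wave_diff_arg: "wave m (s - t) = wave m s * wave (- m) t"
  by (simp add: wave_def cis_mult algebra_simps)

lemma wave_add_of_int [simp]: "wave m (t + of_int k) = wave m t"
proof -
  have "cis (2 * pi * of_int (m * k)) = 1"
    unfolding cis_eq_1_iff by (intro exI[of _ "m * k"]) simp
  then have "wave m (of_int k) = 1" by (simp add: wave_def mult.assoc)
  moreover have "wave m (t + of_int k) = wave m t * wave m (of_int k)"
    by (simp add: wave_def cis_mult distrib_left)
  ultimately show ?thesis by simp
qed

lemma wave_frac [simp]: "wave m (frac t) = wave m t"
  using wave_add_of_int[of m t "- \<lfloor>t\<rfloor>"] by (simp add: frac_def)

lemma wave_1_eq_1_iff: "wave 1 t = 1 \<longleftrightarrow> t \<in> \<int>"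
  by (auto simp: wave_def cis_eq_1_iff Ints_def)

lemma inj_on_wave_1: "inj_on (wave 1) {0..<1}"
proof (rule inj_onI)
  fix s t :: real assume *: "s \<in> {0..<1}" "t \<in> {0..<1}" "wave 1 s = wave 1 t"
  have "wave 1 (s - t) = wave (1 + - 1) t" unfolding wave_diff_arg wave_add * ..
  then have "s - t \<in> \<int>" by (simp add: wave_1_eq_1_iff)
  then obtain k where "s - t = of_int k" by (auto elim: Ints_cases)
  moreover from this have "k = 0" using * by auto
  ultimately show "s = t" by simp
qed

lemma continuous_on_wave [continuous_intros]: "continuous_on A (wave m)"
  unfolding wave_def by (intro continuous_intros)

lemma isCont_wave: "isCont (wave m) t"
  using continuous_on_wave[of UNIV m] by (simp add: continuous_on_eq_continuous_at)

lemma borel_measurable_wave [measurable]: "wave m \<in> borel_measurable borel"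
  by (intro borel_measurable_continuous_onI continuous_on_wave)

lemma wave_set_integral:
  shows set_integrable_wave: "set_integrable lborel {0..1} (wave m)"
    and set_integral_wave: "(LINT t:{0..1}|lborel. wave m t) = (if m = 0 then 1 else 0)"
proof -
  show "set_integrable lborel {0..1} (wave m)"
    by (intro borel_integrable_atLeastAtMost' continuous_on_wave)
  show "(LINT t:{0..1}|lborel. wave m t) = (if m = 0 then 1 else 0)"
  proof (cases "m = 0")
    case True
    then show ?thesis by (simp add: set_lebesgue_integral_def measure_def)
  next
    case False
    have "(LINT t:{0..1}|lborel. wave m t)
        = wave m 1 / (2 * pi * \<i> * of_int m) - wave m 0 / (2 * pi * \<i> * of_int m)"
      unfolding set_lebesgue_integral_def
    proof (rule integral_FTC_Icc)
      fix t :: real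
      have "((\<lambda>t. cis (2 * pi * of_int m * t)) has_vector_derivative
          (2 * pi * of_int m) *\<^sub>R (\<i> * cis (2 * pi * of_int m * t))) (at t within {0..1})"
        unfolding cis_conv_exp
        by (auto intro!: derivative_eq_intros has_vector_derivative_real_field
            simp: scaleR_conv_of_real)
      then show "((\<lambda>t. wave m t / (2 * pi * \<i> * of_int m)) has_vector_derivative wave m t)
          (at t within {0..1})"
        using has_vector_derivative_divide[of "wave m" "2 * pi * of_int m * \<i> * wave m t" "at t within {0..1}"
            "2 * pi * \<i> * of_int m"] False
        by (simp add: wave_def[abs_def] scaleR_conv_of_real mult_ac)
    qed (simp_all add: continuous_on_wave)
    also have "wave m 1 = wave m 0" using wave_add_of_int[of m 0 1] by simp
    finally show ?thesis using False by simp
  qed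
qed

text \<open>The circle is modelled by the fundamental domain \<open>{0..<1}\<close> inside the line,
  so that distribution functions and weak convergence on the line apply.\<close>

locale circle_distribution = real_distribution +
  assumes AE_unit: "AE t in M. t \<in> {0..<1}"

lemma (in finite_measure) integrable_bounded:
  fixes f :: "'a \<Rightarrow> 'b::{banach, second_countable_topology}"
  assumes "\<And>x. norm (f x) \<le> B" "f \<in> borel_measurable M"
  shows "integrable M f"
  using assms by (intro integrable_const_bound[of f B]) auto

lemma cis_eq_wave: "cis (2 * pi * of_int m * t) = wave m t"
  by (simp add: wave_def)

text \<open>By the Stone--Weierstrass theorem, integrals of continuous functions of \<open>wave 1 t\<close> agree; the
  indicators of the arcs \<open>wave 1 ` {0..b}\<close> are limits of such functions.\<close>

lemma wave_moments_unique:
  assumes M: "finite_borel_measure M" "AE t in M. t \<in> {0..<1}"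
    and N: "finite_borel_measure N" "AE t in N. t \<in> {0..<1}"
    and moments: "\<And>m. (LINT t|M. wave m t) = (LINT t|N. wave m t)"
  shows "M = N"
proof -
  interpret M: finite_borel_measure M by fact
  interpret N: finite_borel_measure N by fact
  note [measurable_cong] = M.M_is_borel N.M_is_borel
  \<comment> \<open>Asking for agreement against all waves makes this class closed under
    multiplication by waves, hence by polynomials in \<open>wave 1 t\<close>; the bound ensures
    integrability.\<close>
  define good where "good h \<longleftrightarrow> h \<in> borel_measurable borel \<and> (\<exists>B. \<forall>t. norm (h t) \<le> B) \<and>
      (\<forall>m. (LINT t|M. h t * wave m t) = (LINT t|N. h t * wave m t))" for h :: "real \<Rightarrow> complex"
  have good_int: "integrable M (\<lambda>t. h t * wave m t)" "integrable N (\<lambda>t. h t * wave m t)"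
    if h: "good h" for h m
  proof -
    obtain B where B: "\<forall>t. norm (h t) \<le> B" using h by (auto simp: good_def)
    have [measurable]: "h \<in> borel_measurable borel" using that by (simp add: good_def)
    show "integrable M (\<lambda>t. h t * wave m t)" "integrable N (\<lambda>t. h t * wave m t)"
      using B by (auto intro!: M.integrable_bounded[of _ B] N.integrable_bounded[of _ B] simp: norm_mult)
  qed
  have good_1: "good (\<lambda>_. 1)" using moments by (auto simp: good_def)
  have good_wave: "good (\<lambda>t. h t * wave k t)" if "good h" for h k
    using that by (auto simp: good_def norm_mult mult.assoc simp flip: wave_add)
  have good_cmult: "good (\<lambda>t. a * h t)" if h: "good h" for h a
  proof -
    obtain B where "\<forall>t. norm (h t) \<le> B" using h by (auto simp: good_def)
    then have "norm (a * h t) \<le> norm a * B" for t by (simp add: norm_mult mult_left_mono)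
    then show ?thesis using that by (auto simp: good_def mult.assoc)
  qed
  have good_add: "good (\<lambda>t. g t + h t)" if gh: "good g" "good h" for g h
  proof -
    obtain B C where "\<forall>t. norm (g t) \<le> B" "\<forall>t. norm (h t) \<le> C"
      using gh by (auto simp: good_def)
    then have "norm (g t + h t) \<le> B + C" for t by (intro norm_triangle_mono) auto
    moreover have "(LINT t|M. (g t + h t) * wave m t) = (LINT t|N. (g t + h t) * wave m t)" for m
      using that good_int by (simp add: distrib_right) (simp add: good_def)
    ultimately show ?thesis using that by (auto simp: good_def)
  qed
  have good_poly: "good (\<lambda>t. h t * of_real (p (wave 1 t)))"
    if "real_polynomial_function p" "good h" for p h
    using that
  proof (induction arbitrary: h)
    case (linear p)
    note h = \<open>good h\<close>
    interpret bounded_linear p by fact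
    \<comment> \<open>A real-linear functional on the plane is
      \<open>p z = a * z + cnj a * cnj z\<close>; this \<open>a\<close> comes from
      \<open>Re z = (z + cnj z) / 2\<close> and
      \<open>Im z = - \<i> * (z - cnj z) / 2\<close>.\<close>
    define a where "a = (of_real (p 1) - \<i> * of_real (p \<i>)) / 2"
    have "of_real (p z) = a * z + cnj a * cnj z" for z
    proof -
      have "p z = p (Re z *\<^sub>R 1 + Im z *\<^sub>R \<i>)"
        by (rule arg_cong[of _ _ p]) (simp add: complex_eq_iff)
      also have "\<dots> = Re z * p 1 + Im z * p \<i>" by (simp only: add scaleR) simp
      finally show ?thesis by (simp add: a_def complex_eq_iff field_simps)
    qed
    then have "(\<lambda>t. h t * of_real (p (wave 1 t))) = (\<lambda>t. a * (h t * wave 1 t) + cnj a * (h t * wave (-1) t))"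
      by (simp add: algebra_simps)
    then show ?case using h by (simp only: good_add good_cmult good_wave)
  next
    case (const c)
    then show ?case using good_cmult[of h c] by (simp add: mult.commute)
  next
    case (add f g)
    then show ?case by (simp add: distrib_left good_add)
  next
    case (mult f g)
    \<comment> \<open>As \<open>h\<close> is arbitrary in the induction, the first factor is
      absorbed into it before the second is treated.\<close>
    from mult.IH(2)[OF mult.IH(1)[OF mult.prems]] show ?case by (simp add: mult.assoc)
  qed
  have cont: "(LINT t|M. g (wave 1 t)) = (LINT t|N. g (wave 1 t))"
    if g: "continuous_on UNIV g" for g :: "complex \<Rightarrow> real"
  proof -
    have [measurable]: "g \<in> borel_measurable borel" using g by (rule borel_measurable_continuous_onI)
    have "compact (g ` sphere 0 1)"
      using g by (intro compact_continuous_image continuous_on_subset[OF g]) auto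
    then obtain B where "\<forall>z\<in>sphere 0 1. \<bar>g z\<bar> \<le> B"
      using compact_imp_bounded[of "g ` sphere 0 1"] by (auto simp: bounded_iff)
    then have B: "\<bar>g (wave 1 t)\<bar> \<le> B" for t by simp
    have ig: "integrable M (\<lambda>t. g (wave 1 t))" "integrable N (\<lambda>t. g (wave 1 t))"
      using B by (auto intro!: M.integrable_bounded[of _ B] N.integrable_bounded[of _ B])
    define C where "C = measure M (space M) + measure N (space N)"
    have "\<bar>(LINT t|M. g (wave 1 t)) - (LINT t|N. g (wave 1 t))\<bar> \<le> C * e" if "e > 0" for e
    proof -
      obtain p where p: "real_polynomial_function p" "\<And>z. z \<in> sphere 0 1 \<Longrightarrow> \<bar>g z - p z\<bar> < e"
        using Stone_Weierstrass_real_polynomial_function[of "sphere (0::complex) 1" g e]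
          continuous_on_subset[OF g] \<open>e > 0\<close> by auto
      have "continuous_on UNIV p"
        using p(1) by (simp add: continuous_on_polymonial_function real_polynomial_function_eq)
      then have [measurable]: "p \<in> borel_measurable borel" by (rule borel_measurable_continuous_onI)
      have le: "\<bar>g (wave 1 t) - p (wave 1 t)\<bar> \<le> e" for t
        using p(2)[of "wave 1 t"] by simp
      have "\<bar>p (wave 1 t)\<bar> \<le> B + e" for t
        using B[of t] le[of t] by linarith
      then have ip: "integrable M (\<lambda>t. p (wave 1 t))" "integrable N (\<lambda>t. p (wave 1 t))"
        by (auto intro!: M.integrable_bounded[of _ "B + e"] N.integrable_bounded[of _ "B + e"])
      have "good (\<lambda>t. of_real (p (wave 1 t)))" using good_poly[OF p(1) good_1] by simp
      then have "(LINT t|M. complex_of_real (p (wave 1 t)) * wave 0 t)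
          = (LINT t|N. complex_of_real (p (wave 1 t)) * wave 0 t)"
        unfolding good_def by blast
      then have eq: "(LINT t|M. p (wave 1 t)) = (LINT t|N. p (wave 1 t))" by simp
      have "\<bar>LINT t|M. g (wave 1 t) - p (wave 1 t)\<bar> \<le> (LINT t|M. e)"
        using le ig ip by (intro order_trans[OF integral_abs_bound] integral_mono) auto
      moreover have "\<bar>LINT t|N. g (wave 1 t) - p (wave 1 t)\<bar> \<le> (LINT t|N. e)"
        using le ig ip by (intro order_trans[OF integral_abs_bound] integral_mono) auto
      ultimately show ?thesis using ig ip eq by (simp add: C_def distrib_right)
    qed
    note bound = this
    have "\<forall>\<^sub>F e in at_right 0. \<bar>(LINT t|M. g (wave 1 t)) - (LINT t|N. g (wave 1 t))\<bar> \<le> C * e"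
      using eventually_at_right_less[of 0] by eventually_elim (rule bound)
    moreover have "((\<lambda>e. C * e) \<longlongrightarrow> C * 0) (at_right 0)" by (intro tendsto_intros)
    ultimately have "\<bar>(LINT t|M. g (wave 1 t)) - (LINT t|N. g (wave 1 t))\<bar> \<le> C * 0"
      by (intro tendsto_lowerbound) auto
    then show ?thesis by simp
  qed
  have interval: "measure M {0..b} = measure N {0..b}" if b: "0 \<le> b" "b < 1" for b
  proof -
    define K where "K = wave 1 ` {0..b}"
    have K: "closed K" "K \<noteq> {}"
      using b unfolding K_def
      by (auto intro!: compact_imp_closed compact_continuous_image continuous_on_wave)
    \<comment> \<open>Continuous functions decreasing to the indicator of the closed arc
      \<open>K\<close>.\<close>
    define g where "g n z = max 0 (1 - real n * infdist z K)" for n z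
    have lim: "(\<lambda>n. g n (wave 1 t)) \<longlonglongrightarrow> indicat_real {0..b} t" if t: "t \<in> {0..<1}" for t
    proof (cases "t \<in> {0..b}")
      case True
      then show ?thesis by (simp add: g_def K_def)
    next
      case False
      \<comment> \<open>\<open>b < 1\<close> puts \<open>{0..b}\<close> inside the domain on which
        \<open>wave 1\<close> is injective.\<close>
      then have "wave 1 t \<notin> K"
        using inj_on_wave_1 t b by (auto simp: K_def dest!: inj_onD)
      then have d: "infdist (wave 1 t) K > 0" using K by (simp add: infdist_pos_not_in_closed)
      have "\<forall>\<^sub>F n in sequentially. g n (wave 1 t) = 0"
        using eventually_ge_at_top[of "nat \<lceil>1 / infdist (wave 1 t) K\<rceil>"]
      proof eventually_elim
        case (elim n)
        then have "1 / infdist (wave 1 t) K \<le> real n" by linarith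
        then show ?case using d by (simp add: g_def field_simps)
      qed
      then show ?thesis using False by (simp add: tendsto_eventually)
    qed
    have contg: "continuous_on UNIV (g n)" for n
      unfolding g_def by (intro continuous_intros)
    then have [measurable]: "g n \<in> borel_measurable borel" for n
      by (rule borel_measurable_continuous_onI)
    have bound: "\<bar>g n z\<bar> \<le> 1" for n z by (simp add: g_def infdist_nonneg)
    have "(\<lambda>n. LINT t|M. g n (wave 1 t)) \<longlonglongrightarrow> (LINT t|M. indicat_real {0..b} t)"
      using bound AE_mp[OF M(2) AE_I2] lim
      by (intro integral_dominated_convergence[where w = "\<lambda>_. 1"]) auto
    moreover have "(\<lambda>n. LINT t|N. g n (wave 1 t)) \<longlonglongrightarrow> (LINT t|N. indicat_real {0..b} t)"
      using bound AE_mp[OF N(2) AE_I2] lim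
      by (intro integral_dominated_convergence[where w = "\<lambda>_. 1"]) auto
    ultimately have "(LINT t|M. indicat_real {0..b} t) = (LINT t|N. indicat_real {0..b} t)"
      using cont[OF contg] by (simp add: LIMSEQ_unique)
    then show ?thesis by simp
  qed
  have total: "measure M UNIV = measure N UNIV"
    using cont[of "\<lambda>_. 1"] M.borel_UNIV N.borel_UNIV by simp
  \<comment> \<open>As the mass sits on \<open>{0..<1}\<close>, the intervals \<open>{0..b}\<close>
    with \<open>b < 1\<close> and the total mass determine the distribution function.\<close>
  have cases: "measure K {..b} = (if b < 0 then 0 else if b < 1 then measure K {0..b} else measure K UNIV)"
    if "finite_borel_measure K" "AE t in K. t \<in> {0..<1}" for K b
  proof -
    interpret K: finite_borel_measure K by fact
    have "measure K {..b} = measure K (if b < 0 then {} else if b < 1 then {0..b} else UNIV)"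
    proof (rule K.finite_measure_eq_AE)
      show "AE t in K. t \<in> {..b} \<longleftrightarrow> t \<in> (if b < 0 then {} else if b < 1 then {0..b} else UNIV)"
        using that(2) by eventually_elim auto
    qed auto
    then show ?thesis by simp
  qed
  show ?thesis
    by (rule cdf_unique'[OF M(1) N(1)])
      (simp add: fun_eq_iff cdf_def cases[OF M] cases[OF N] interval total)
qed

section \<open>Periodic measures\<close>

definition periodise :: "real measure \<Rightarrow> real measure" where
  "periodise M = distr (M \<Otimes>\<^sub>M count_space (UNIV :: int set)) borel (\<lambda>(t, k). t + of_int k)"

text \<open>A density, unlike a restricted space, remains a measure on all Borel sets of the
  line.\<close>

definition unit_part :: "real measure \<Rightarrow> real measure" where
  "unit_part \<mu> = density \<mu> (indicator {0..<1})"

lemma sets_unit_part [simp]: "sets (unit_part \<mu>) = sets \<mu>"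
  by (simp add: unit_part_def)

lemma emeasure_unit_part:
  assumes "sets \<mu> = sets borel" "B \<in> sets borel"
  shows "emeasure (unit_part \<mu>) B = emeasure \<mu> ({0..<1} \<inter> B)"
proof -
  note [measurable_cong] = assms(1)
  have "emeasure (unit_part \<mu>) B = (\<integral>\<^sup>+ t. indicator ({0..<1} \<inter> B) t \<partial>\<mu>)"
    using assms by (simp add: unit_part_def emeasure_density indicator_inter_arith)
  then show ?thesis using assms by simp
qed

lemma integral_unit_part:
  fixes f :: "real \<Rightarrow> 'b::{banach, second_countable_topology}"
  assumes "sets \<mu> = sets borel" "f \<in> borel_measurable borel"
  shows "(LINT t|unit_part \<mu>. f t) = (LINT t:{0..<1}|\<mu>. f t)"
proof -
  note [measurable_cong] = assms(1)
  note [measurable] = assms(2)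
  have "unit_part \<mu> = density \<mu> (\<lambda>t. ennreal (indicator {0..<1} t))"
    by (simp add: unit_part_def ennreal_indicator)
  then show ?thesis
    using assms by (simp add: integral_density set_lebesgue_integral_def)
qed

lemma AE_unit_part:
  assumes "sets \<mu> = sets borel"
  shows "AE t in unit_part \<mu>. t \<in> {0..<1}"
proof -
  note [measurable_cong] = assms(1)
  show ?thesis unfolding unit_part_def by (subst AE_density) (auto split: split_indicator)
qed

lemma finite_borel_measure_unit_part:
  assumes "is_fourier_transform \<eta> \<mu>"
  shows "finite_borel_measure (unit_part \<mu>)"
proof (intro finite_borel_measure.intro finite_measureI finite_borel_measure_axioms.intro)
  have \<mu>: "sets \<mu> = sets borel" "emeasure \<mu> {0..<1} < \<infinity>"
    using assms by (auto simp: is_fourier_transform_def)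
  then show "sets (unit_part \<mu>) = sets borel" by simp
  have "space (unit_part \<mu>) = UNIV"
    using \<mu> sets_eq_imp_space_eq[of "unit_part \<mu>" borel] by simp
  then show "emeasure (unit_part \<mu>) (space (unit_part \<mu>)) \<noteq> \<infinity>"
    using \<mu> by (simp add: emeasure_unit_part)
qed

lemma periodic_emeasure_shift:
  fixes \<mu> :: "real measure"
  assumes sets: "sets \<mu> = sets borel" and per: "\<forall>B\<in>sets borel. emeasure \<mu> ((+) 1 ` B) = emeasure \<mu> B"
    and B: "B \<in> sets borel"
  shows "emeasure \<mu> ((\<lambda>t. t + of_int k) -` B) = emeasure \<mu> B"
proof -
  have meas: "(\<lambda>t. t + of_int k) -` B \<in> sets borel" for k
    using B measurable_sets_borel[of "\<lambda>t. t + of_int k" borel B] by simp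
  have step: "emeasure \<mu> ((\<lambda>t. t + of_int (k + 1)) -` B) = emeasure \<mu> ((\<lambda>t. t + of_int k) -` B)" for k
  proof -
    have "(+) 1 ` ((\<lambda>t. t + real_of_int (k + 1)) -` B) = (\<lambda>t. t + of_int k) -` B"
    proof (intro set_eqI iffI)
      fix t assume "t \<in> (\<lambda>t. t + of_int k) -` B"
      then show "t \<in> (+) 1 ` ((\<lambda>t. t + real_of_int (k + 1)) -` B)"
        by (intro image_eqI[of _ _ "t - 1"]) auto
    qed (auto simp: algebra_simps)
    then show ?thesis using per[rule_format, OF meas[of "k + 1"]] by simp
  qed
  show ?thesis
  proof (induction k rule: int_induct[where k = 0])
    case (step1 i)
    then show ?case using step[of i] by simp
  next
    case (step2 i)
    then show ?case using step[of "i - 1"] by simp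
  qed simp
qed

text \<open>Cutting \<open>B\<close> at the integers and moving each piece back to
  \<open>{0..<1}\<close> shows that a periodic measure is determined by its unit part.\<close>

lemma periodic_emeasure_eq:
  assumes sets: "sets \<mu> = sets borel" and per: "\<forall>B\<in>sets borel. emeasure \<mu> ((+) 1 ` B) = emeasure \<mu> B"
    and B: "B \<in> sets borel"
  shows "emeasure \<mu> B =
    (\<integral>\<^sup>+ k. emeasure (unit_part \<mu>) ((\<lambda>t. t + of_int k) -` B) \<partial>count_space (UNIV :: int set))"
proof -
  define X where "X k = B \<inter> {of_int k..<of_int k + 1}" for k :: int
  have "B = (\<Union>k. X k)"
  proof (intro set_eqI iffI)
    fix t assume "t \<in> B"
    then have "t \<in> X \<lfloor>t\<rfloor>" by (simp add: X_def)
    then show "t \<in> (\<Union>k. X k)" by blast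
  qed (auto simp: X_def)
  then have "emeasure \<mu> B = emeasure \<mu> (\<Union>(range X))" by simp
  also have "\<dots> = (\<integral>\<^sup>+ k. emeasure \<mu> (X k) \<partial>count_space UNIV)"
  proof (rule emeasure_UN_countable)
    show "disjoint_family_on X UNIV"
      unfolding disjoint_family_on_def
    proof (intro ballI impI)
      fix k l :: int assume "k \<noteq> l"
      then show "X k \<inter> X l = {}" by (auto simp: X_def)
    qed
  qed (use B sets in \<open>auto simp: X_def\<close>)
  finally have "emeasure \<mu> B = (\<integral>\<^sup>+ k. emeasure \<mu> (X k) \<partial>count_space UNIV)" .
  moreover have "emeasure \<mu> (X k) = emeasure (unit_part \<mu>) ((\<lambda>t. t + of_int k) -` B)" for k
  proof -
    have meas: "(\<lambda>t. t + of_int k) -` B \<in> sets borel"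
      using B measurable_sets_borel[of "\<lambda>t. t + of_int k" borel B] by simp
    have "(\<lambda>t. t + of_int k) -` X k = {0..<1} \<inter> (\<lambda>t. t + of_int k) -` B"
      by (auto simp: X_def)
    moreover have "X k \<in> sets borel" using B by (simp add: X_def)
    ultimately show ?thesis
      using periodic_emeasure_shift[OF sets per, of "X k" k] emeasure_unit_part[OF sets meas] by simp
  qed
  ultimately show ?thesis by simp
qed

text \<open>The moments determine the unit parts, and these the periodic measures. With existence,
  this justifies the definite description in \<open>diffraction\<close>.\<close>

lemma is_fourier_transform_unique:
  assumes "is_fourier_transform \<eta> \<mu>" "is_fourier_transform \<eta> \<nu>"
  shows "\<mu> = \<nu>"
proof -
  have sets: "sets \<mu> = sets borel" "sets \<nu> = sets borel"
    and per: "\<forall>B\<in>sets borel. emeasure \<mu> ((+) 1 ` B) = emeasure \<mu> B"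
      "\<forall>B\<in>sets borel. emeasure \<nu> ((+) 1 ` B) = emeasure \<nu> B"
    and coeff: "\<And>m. (LINT t:{0..<1}|\<mu>. wave m t) = \<eta> m" "\<And>m. (LINT t:{0..<1}|\<nu>. wave m t) = \<eta> m"
    using assms by (auto simp: is_fourier_transform_def cis_eq_wave)
  have eq: "unit_part \<mu> = unit_part \<nu>"
    using assms sets coeff
    by (intro wave_moments_unique finite_borel_measure_unit_part AE_unit_part)
      (simp_all add: integral_unit_part)
  show ?thesis
  proof (rule measure_eqI)
    show "sets \<mu> = sets \<nu>" using sets by simp
    fix B assume "B \<in> sets \<mu>"
    then have B: "B \<in> sets borel" using sets by simp
    show "emeasure \<mu> B = emeasure \<nu> B"
      unfolding periodic_emeasure_eq[OF sets(1) per(1) B] periodic_emeasure_eq[OF sets(2) per(2) B] eq ..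
  qed
qed

section \<open>Periodisation of measures on the circle\<close>

context circle_distribution
begin

text \<open>Tonelli, with the integers integrated out first: a point is weighted by the number of
  its translates in \<open>B\<close>.\<close>

lemma emeasure_periodise:
  assumes "B \<in> sets borel"
  shows "emeasure (periodise M) B = (\<integral>\<^sup>+ t. emeasure (count_space UNIV) {k::int. t + of_int k \<in> B} \<partial>M)"
proof -
  interpret C: sigma_finite_measure "count_space (UNIV :: int set)"
    by (rule sigma_finite_measure_count_space)
  have [measurable]: "(\<lambda>(t, k). t + of_int k) \<in> borel_measurable (M \<Otimes>\<^sub>M count_space (UNIV :: int set))"
    by measurable
  have "(\<lambda>(t, k). t + of_int k) -` B \<inter> space (M \<Otimes>\<^sub>M count_space (UNIV :: int set))
      \<in> sets (M \<Otimes>\<^sub>M count_space (UNIV :: int set))"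
    using assms by measurable
  then show ?thesis
    using assms by (simp add: periodise_def emeasure_distr C.emeasure_pair_measure_alt space_pair_measure vimage_def)
qed

lemma sets_periodise: "sets (periodise M) = sets borel"
  by (simp add: periodise_def)

lemma periodise_periodic:
  assumes B: "B \<in> sets borel"
  shows "emeasure (periodise M) ((+) 1 ` B) = emeasure (periodise M) B"
proof -
  have "(+) 1 ` B = (\<lambda>t. t - 1) -` B" by (force simp: algebra_simps)
  moreover have "(\<lambda>t. t - 1) -` B \<in> sets borel"
    using B measurable_sets_borel[of "\<lambda>t. t - 1" borel B] by simp
  ultimately have "(+) 1 ` B \<in> sets borel" by simp
  moreover have "emeasure (count_space UNIV) {k::int. t + of_int k \<in> (+) 1 ` B}
      = emeasure (count_space UNIV) {k::int. t + of_int k \<in> B}" for t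
  proof -
    have "bij_betw (\<lambda>k. k + 1) {k::int. t + of_int k \<in> B} {k. t + of_int k \<in> (+) 1 ` B}"
      by (intro bij_betwI[where g = "\<lambda>k. k - 1"]) (auto simp: image_iff algebra_simps)
    then show ?thesis
      using bij_betw_finite bij_betw_same_card by (fastforce simp: emeasure_count_space)
  qed
  ultimately show ?thesis using B by (simp add: emeasure_periodise)
qed

text \<open>Of the integer translates of a point of \<open>{0..<1}\<close>, only that by
  \<open>0\<close> lies in \<open>{0..<1}\<close>.\<close>

lemma unit_part_periodise: "unit_part (periodise M) = M"
proof (rule measure_eqI)
  show "sets (unit_part (periodise M)) = sets M" by (simp add: sets_periodise)
  fix B assume "B \<in> sets (unit_part (periodise M))"
  then have B [measurable]: "B \<in> sets borel" by (simp add: sets_periodise)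
  have count: "emeasure (count_space UNIV) {k::int. t + of_int k \<in> {0..<1} \<inter> B} = indicator B t"
    if t: "t \<in> {0..<1}" for t
  proof -
    have "{k::int. t + of_int k \<in> {0..<1} \<inter> B} = (if t \<in> B then {0} else {})"
    proof (intro set_eqI)
      fix k :: int
      have "t + of_int k \<in> {0..<1} \<longleftrightarrow> k = 0" using t by auto
      then show "k \<in> {k. t + of_int k \<in> {0..<1} \<inter> B} \<longleftrightarrow> k \<in> (if t \<in> B then {0} else {})"
        by auto
    qed
    then show ?thesis by (simp add: emeasure_count_space)
  qed
  have "emeasure (unit_part (periodise M)) B = emeasure (periodise M) ({0..<1} \<inter> B)"
    using B sets_periodise by (intro emeasure_unit_part)
  also have "\<dots> =
      (\<integral>\<^sup>+ t. emeasure (count_space UNIV) {k::int. t + of_int k \<in> {0..<1} \<inter> B} \<partial>M)"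
    by (rule emeasure_periodise) simp
  also have "\<dots> = (\<integral>\<^sup>+ t. indicator B t \<partial>M)"
  proof (rule nn_integral_cong_AE)
    show "AE t in M. emeasure (count_space UNIV) {k::int. t + of_int k \<in> {0..<1} \<inter> B} = indicator B t"
      using AE_unit by eventually_elim (rule count)
  qed
  finally show "emeasure (unit_part (periodise M)) B = emeasure M B" by simp
qed

lemma is_fourier_transform_periodise:
  "is_fourier_transform (\<lambda>m. LINT t|M. wave m t) (periodise M)"
proof -
  have "emeasure (periodise M) {0..<1} = emeasure (unit_part (periodise M)) UNIV"
    by (simp add: emeasure_unit_part sets_periodise)
  then have "emeasure (periodise M) {0..<1} < \<infinity>"
    by (simp add: unit_part_periodise less_top[symmetric])
  moreover have "(LINT t:{0..<1}|periodise M. wave m t) = (LINT t|M. wave m t)" for m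
    using integral_unit_part[OF sets_periodise, of "wave m"] by (simp add: unit_part_periodise)
  ultimately show ?thesis
    by (auto simp: is_fourier_transform_def cis_eq_wave sets_periodise periodise_periodic)
qed

end

text \<open>Waves do not notice folding the line into \<open>{0..<1}\<close>. This serves for weak
  limits of measures on \<open>{0..1}\<close>, which may charge the endpoint
  \<open>1\<close>.\<close>

lemma (in real_distribution) circle_distribution_frac:
  shows "circle_distribution (distr M borel frac)"
    and "(LINT t|distr M borel frac. wave m t) = (LINT t|M. wave m t)"
proof -
  have [measurable]: "(frac :: real \<Rightarrow> real) \<in> borel_measurable borel"
    unfolding frac_def by measurable
  interpret D: prob_space "distr M borel frac" by (rule prob_space_distr) simp
  show "circle_distribution (distr M borel frac)"
  proof
    show "AE t in distr M borel frac. t \<in> {0..<1}"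
      by (subst AE_distr_iff) (auto simp: frac_lt_1)
  qed simp
  show "(LINT t|distr M borel frac. wave m t) = (LINT t|M. wave m t)"
    by (subst integral_distr) auto
qed

section \<open>Existence of the diffraction measure\<close>

text \<open>The Fourier coefficients of the periodogram are truncated autocorrelations, so the diffraction
  is a weak limit of the measures with these densities.\<close>

definition periodogram :: "(int \<Rightarrow> complex) \<Rightarrow> nat \<Rightarrow> real \<Rightarrow> real" where
  "periodogram f N t = (norm (\<Sum>n\<in>{- int N..int N}. f n * wave n t))\<^sup>2 / (2 * real N + 1)"

lemma periodogram_nonneg: "0 \<le> periodogram f N t"
  by (simp add: periodogram_def)

lemma borel_measurable_periodogram [measurable]: "periodogram f N \<in> borel_measurable borel"
  unfolding periodogram_def by measurable

lemma of_real_periodogram: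
  "of_real (periodogram f N t) * wave m t = (\<Sum>n\<in>{- int N..int N}. \<Sum>k\<in>{- int N..int N}.
     f n * cnj (f k) / (2 * of_nat N + 1) * wave (n - k + m) t)"
proof -
  have "of_real (periodogram f N t) * wave m t =
      (\<Sum>n\<in>{- int N..int N}. f n * wave n t) * cnj (\<Sum>n\<in>{- int N..int N}. f n * wave n t) /
        (2 * of_nat N + 1) * wave m t"
    unfolding complex_norm_square[symmetric] by (simp add: periodogram_def)
  also have "\<dots> = (\<Sum>n\<in>{- int N..int N}. \<Sum>k\<in>{- int N..int N}.
      (f n * wave n t) * (cnj (f k) * wave (- k) t) / (2 * of_nat N + 1) * wave m t)"
    by (subst sum.swap) (simp add: sum_divide_distrib sum_distrib_right sum_distrib_left)
  also have "\<dots> = (\<Sum>n\<in>{- int N..int N}. \<Sum>k\<in>{- int N..int N}.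
      f n * cnj (f k) / (2 * of_nat N + 1) * wave (n - k + m) t)"
    unfolding diff_conv_add_uminus wave_add by (simp add: mult_ac)
  finally show ?thesis .
qed

text \<open>Orthogonality leaves the pairs with \<open>k = n + m\<close>, where both indices must
  lie in the window.\<close>

lemma set_integral_periodogram:
  "(LINT t:{0..1}|lborel. of_real (periodogram f N t) * wave m t) =
     (\<Sum>n | n \<in> {- int N..int N} \<and> n + m \<in> {- int N..int N}. f n * cnj (f (n + m))) / (2 * of_nat N + 1)"
proof -
  let ?W = "{- int N..int N}"
  have "(LINT t:{0..1}|lborel. of_real (periodogram f N t) * wave m t) =
      (\<Sum>n\<in>?W. \<Sum>k\<in>?W. f n * cnj (f k) / (2 * of_nat N + 1) * (if k = n + m then 1 else 0))"
  proof -
    have i: "(LINT t:{0..1}|lborel. a * wave l t) = a * (if l = 0 then 1 else 0)" for a l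
      using set_integral_wave[of l] by simp
    have eq: "n - k + m = 0 \<longleftrightarrow> k = n + m" for n k by auto
    have int: "integrable lborel (\<lambda>t. indicator {0..1} t *\<^sub>R (a * wave l t))" for a l
      using set_integrable_mult_right[of a lborel "{0..1}" "wave l"] set_integrable_wave
      by (simp add: set_integrable_def)
    show ?thesis
      unfolding of_real_periodogram set_lebesgue_integral_def scaleR_sum_right
      by (simp only: Bochner_Integration.integral_sum Bochner_Integration.integrable_sum int
          i[unfolded set_lebesgue_integral_def] eq)
  qed
  also have "\<dots> = (\<Sum>n\<in>?W. if n + m \<in> ?W then f n * cnj (f (n + m)) / (2 * of_nat N + 1) else 0)"
    by (intro sum.cong refl) (simp add: if_distrib[of "(*) _"] cong: if_cong)
  also have "\<dots> = (\<Sum>n\<in>?W \<inter> {n. n + m \<in> ?W}. f n * cnj (f (n + m)) / (2 * of_nat N + 1))"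
    by (simp add: sum.inter_restrict)
  also have "?W \<inter> {n. n + m \<in> ?W} = {n. n \<in> ?W \<and> n + m \<in> ?W}" by auto
  finally show ?thesis by (simp only: sum_divide_distrib)
qed

text \<open>Truncation loses at most \<open>2 * \<bar>m\<bar>\<close> terms, all near the ends of
  the window.\<close>

lemma periodogram_tendsto:
  assumes norm: "\<And>n. norm (f n) = 1"
    and lim: "(\<lambda>N. correlation_sum f N m / of_nat (2 * N + 1)) \<longlonglongrightarrow> \<eta>"
  shows "(\<lambda>N. LINT t:{0..1}|lborel. of_real (periodogram f N t) * wave m t) \<longlonglongrightarrow> \<eta>"
proof -
  have "(\<lambda>N. (LINT t:{0..1}|lborel. of_real (periodogram f N t) * wave m t) -
      correlation_sum f N m / of_nat (2 * N + 1)) \<longlonglongrightarrow> 0"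
  proof (rule Lim_null_comparison[OF _ lim_const_over_window[of "2 * of_int \<bar>m\<bar>"]], rule always_eventually, rule allI)
    fix N
    let ?W = "{- int N..int N}" and ?g = "\<lambda>n. f n * cnj (f (n + m))"
    let ?V = "{n. n \<in> ?W \<and> n + m \<in> ?W}"
    have "?V - ?W = {}" by auto
    then have "card (?V - ?W) = 0" by (simp only: card.empty)
    moreover have "card (?W - ?V) \<le> nat \<bar>m\<bar> + nat \<bar>m\<bar>"
    proof -
      have "?W - ?V \<subseteq> {- int N..<- int N + \<bar>m\<bar>} \<union> {int N - \<bar>m\<bar><..int N}" by auto
      then have "card (?W - ?V) \<le> card ({- int N..<- int N + \<bar>m\<bar>} \<union> {int N - \<bar>m\<bar><..int N})"
        by (intro card_mono) auto
      also have "\<dots> \<le> nat \<bar>m\<bar> + nat \<bar>m\<bar>" by (rule order_trans[OF card_Un_le]) simp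
      finally show ?thesis .
    qed
    moreover have "norm (sum ?g ?V - sum ?g ?W) \<le> real (card (?V - ?W)) + real (card (?W - ?V))"
      by (rule norm_sum_diff_le_card) (auto simp: norm_mult norm intro: finite_subset[of _ ?W])
    ultimately have "norm (sum ?g ?V - sum ?g ?W) \<le> 2 * of_int \<bar>m\<bar>" by linarith
    moreover have "norm (2 * of_nat N + 1 :: complex) = 2 * real N + 1"
      using norm_of_nat[of "2 * N + 1", where 'a = complex] by (simp add: add.commute[of 1])
    ultimately show "norm ((LINT t:{0..1}|lborel. of_real (periodogram f N t) * wave m t) -
        correlation_sum f N m / of_nat (2 * N + 1)) \<le> 2 * of_int \<bar>m\<bar> / (2 * real N + 1)"
      unfolding set_integral_periodogram correlation_sum_def
      by (simp add: norm_divide divide_right_mono add.commute[of 1] flip: diff_divide_distrib)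
  qed
  from tendsto_add[OF this lim] show ?thesis by simp
qed

text \<open>This is Herglotz's theorem for these coefficients. Tightness is immediate because all
  periodogram measures live on \<open>{0..1}\<close>.\<close>

theorem exists_fourier_transform:
  assumes norm: "\<And>n. norm (f n) = 1"
    and lim: "\<And>m. (\<lambda>N. correlation_sum f N m / of_nat (2 * N + 1)) \<longlonglongrightarrow> \<eta> m"
  obtains M where "circle_distribution M" "\<And>m. (LINT t|M. wave m t) = \<eta> m"
proof -
  define g where "g N t = indicator {0..1} t * periodogram f N t" for N t
  define P where "P N = density lborel (\<lambda>t. ennreal (g N t))" for N
  have g [measurable]: "g N \<in> borel_measurable borel" "0 \<le> g N t" for N t
    by (auto simp: g_def[abs_def] periodogram_nonneg)
  have int_P: "(LINT t|P N. wave m t) = (LINT t:{0..1}|lborel. of_real (periodogram f N t) * wave m t)" for N m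
    unfolding P_def set_lebesgue_integral_def using g
    by (subst integral_density) (auto simp: g_def scaleR_conv_of_real intro!: Bochner_Integration.integral_cong)
  have P: "real_distribution (P N)" for N
  proof -
    have "f j * cnj (f j) = 1" for j
      using norm[of j] by (simp add: complex_norm_square[symmetric])
    moreover have "{n. - int N \<le> n \<and> n \<le> int N} = {- int N..int N}" by auto
    \<comment> \<open>For \<open>m = 0\<close> nothing is truncated, so the total mass is the mean
      of \<open>(norm (f n))\<^sup>2\<close>.\<close>
    ultimately have "(LINT t:{0..1}|lborel. of_real (periodogram f N t) * wave 0 t) = 1"
      unfolding set_integral_periodogram by (simp add: add.commute[of _ 1])
    then have "(LINT t|lborel. complex_of_real (g N t)) = 1"
      by (simp add: set_lebesgue_integral_def g_def scaleR_conv_of_real)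
    then have i: "(LINT t|lborel. g N t) = 1" by simp
    \<comment> \<open>A non-integrable function has Bochner integral \<open>0\<close>, so the value
      \<open>1\<close> forces integrability.\<close>
    then have "integrable lborel (g N)" using not_integrable_integral_eq by fastforce
    then have "(\<integral>\<^sup>+ t. g N t \<partial>lborel) = 1"
      using i g by (simp add: nn_integral_eq_integral)
    then have "emeasure (P N) (space (P N)) = 1" by (simp add: P_def emeasure_density)
    then show ?thesis by (intro real_distribution.intro prob_spaceI) (auto simp: real_distribution_axioms_def P_def)
  qed
  have "tight P"
    unfolding tight_def
  proof (intro conjI allI impI P)
    fix \<epsilon> :: real assume "\<epsilon> > 0"
    have "measure (P N) {-1<..1} = 1" for N
    proof -
      interpret real_distribution "P N" by (rule P)
      have "AE t in P N. t \<in> {-1<..1}"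
        unfolding P_def by (subst AE_density) (auto simp: g_def split: split_indicator)
      then show ?thesis by (subst prob_eq_1) auto
    qed
    then show "\<exists>a b. a < b \<and> (\<forall>n. 1 - \<epsilon> < measure (P n) {a<..b})"
      using \<open>\<epsilon> > 0\<close> by (intro exI[of _ "-1"] exI[of _ 1]) auto
  qed
  from tight_imp_convergent_subsubsequence[OF this strict_mono_id]
  obtain r M where r: "strict_mono r" and M: "real_distribution M" and conv: "weak_conv_m (P \<circ> r) M"
    by auto
  interpret M: real_distribution M by fact
  have "(LINT t|M. wave m t) = \<eta> m" for m
  proof (rule LIMSEQ_unique)
    show "(\<lambda>n. LINT t|(P \<circ> r) n. wave m t) \<longlonglongrightarrow> (LINT t|M. wave m t)"
      using P M conv by (intro weak_conv_imp_integral_bdd_continuous_conv[where B = 1]) (auto simp: isCont_wave o_def)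
    show "(\<lambda>n. LINT t|(P \<circ> r) n. wave m t) \<longlonglongrightarrow> \<eta> m"
      using LIMSEQ_subseq_LIMSEQ[OF periodogram_tendsto[OF norm lim] r] by (simp add: int_P o_def)
  qed
  then show thesis
    using M.circle_distribution_frac by (intro that[of "distr M borel frac"]) auto
qed

section \<open>Mean-square convergence\<close>

text \<open>Cesaro's lemma, by splitting off a finite head.\<close>

lemma mean_tendsto_zero:
  fixes e :: "nat \<Rightarrow> real"
  assumes "e \<longlonglongrightarrow> 0"
  shows "(\<lambda>n. (\<Sum>d<n. e d) / real n) \<longlonglongrightarrow> 0"
proof (rule tendstoI)
  fix \<epsilon> :: real assume "\<epsilon> > 0"
  obtain k where k: "\<And>d. d \<ge> k \<Longrightarrow> \<bar>e d\<bar> < \<epsilon> / 2"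
    using LIMSEQ_D[OF assms, of "\<epsilon> / 2"] \<open>\<epsilon> > 0\<close> by auto
  define A where "A = (\<Sum>d<k. \<bar>e d\<bar>)"
  have A: "A \<ge> 0" by (simp add: A_def sum_nonneg)
  \<comment> \<open>Past \<open>2 * A / \<epsilon>\<close> the head \<open>A\<close> is less than
    half of \<open>\<epsilon> * n\<close>.\<close>
  show "\<forall>\<^sub>F n in sequentially. dist ((\<Sum>d<n. e d) / real n) 0 < \<epsilon>"
    using eventually_gt_at_top[of "k + nat \<lceil>2 * A / \<epsilon>\<rceil>"]
  proof eventually_elim
    case (elim n)
    then have n: "k < n" "2 * A / \<epsilon> < real n" using A \<open>\<epsilon> > 0\<close> by linarith+
    have "{..<n} = {..<k} \<union> {k..<n}" using n by auto
    then have "(\<Sum>d<n. \<bar>e d\<bar>) = A + (\<Sum>d\<in>{k..<n}. \<bar>e d\<bar>)"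
      unfolding A_def by (simp add: sum.union_disjoint ivl_disj_int)
    also have "(\<Sum>d\<in>{k..<n}. \<bar>e d\<bar>) \<le> (\<Sum>d\<in>{k..<n}. \<epsilon> / 2)"
      using k by (intro sum_mono) (simp add: less_imp_le)
    also have "\<dots> \<le> real n * (\<epsilon> / 2)"
      using \<open>\<epsilon> > 0\<close> by (simp add: mult_right_mono)
    also have "A + real n * (\<epsilon> / 2) < real n * \<epsilon>"
      using n \<open>\<epsilon> > 0\<close> by (simp add: field_simps)
    finally have "(\<Sum>d<n. \<bar>e d\<bar>) < real n * \<epsilon>" by simp
    then have "\<bar>\<Sum>d<n. e d\<bar> < \<epsilon> * real n"
      by (intro le_less_trans[OF sum_abs]) (simp add: mult.commute)
    then show ?case using n by (simp add: divide_less_eq)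
  qed
qed

text \<open>Each distance \<open>d\<close> occurs at most twice, at \<open>k - d\<close> and at
  \<open>k + d\<close>.\<close>

lemma sum_distance_le:
  fixes e :: "nat \<Rightarrow> real"
  assumes "\<And>d. 0 \<le> e d" "k < n"
  shows "(\<Sum>l<n. e (if l \<le> k then k - l else l - k)) \<le> 2 * (\<Sum>d<n. e d)"
proof -
  have "{..<n} = {..k} \<union> {k<..<n}" using assms by auto
  then have "(\<Sum>l<n. e (if l \<le> k then k - l else l - k)) =
      (\<Sum>l\<in>{..k}. e (k - l)) + (\<Sum>l\<in>{k<..<n}. e (l - k))"
    by (simp add: sum.union_disjoint ivl_disj_int)
  also have "(\<Sum>l\<in>{..k}. e (k - l)) = (\<Sum>d\<in>{..k}. e d)"
    by (rule sum.reindex_bij_witness[of _ "\<lambda>d. k - d" "\<lambda>l. k - l"]) auto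
  also have "(\<Sum>l\<in>{k<..<n}. e (l - k)) = (\<Sum>d\<in>{0<..<n - k}. e d)"
    by (rule sum.reindex_bij_witness[of _ "\<lambda>d. d + k" "\<lambda>l. l - k"]) auto
  also have "(\<Sum>d\<in>{..k}. e d) \<le> (\<Sum>d<n. e d)"
    using assms by (intro sum_mono2) auto
  also have "(\<Sum>d\<in>{0<..<n - k}. e d) \<le> (\<Sum>d<n. e d)"
    using assms by (intro sum_mono2) auto
  finally show ?thesis by simp
qed

text \<open>A law of large numbers: the mean square is the sum of the \<open>n * n\<close>
  covariances over \<open>n * n\<close>. Each row is at most twice the sum of the decaying
  \<open>e d\<close>, which leaves a Cesaro mean.\<close>

lemma (in prob_space) mean_square_tendsto_zero:
  fixes X :: "nat \<Rightarrow> 'a \<Rightarrow> complex"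
  assumes X [measurable]: "\<And>k. X k \<in> borel_measurable M"
    and bounded: "\<And>k x. norm (X k x) \<le> B"
    and mean: "\<And>k. (LINT x|M. X k x) = a"
    and correlation: "\<And>k l. l \<le> k \<Longrightarrow> (LINT x|M. X k x * cnj (X l x)) = r (k - l)"
    and lim: "r \<longlonglongrightarrow> a * cnj a"
  shows "(\<lambda>n. LINT x|M. (norm ((\<Sum>k<n. X k x) / of_nat n - a))\<^sup>2) \<longlonglongrightarrow> 0"
proof -
  define Y where "Y k x = X k x - a" for k x
  define e where "e d = norm (r d - a * cnj a)" for d
  have Y [measurable]: "Y k \<in> borel_measurable M" for k unfolding Y_def[abs_def] by measurable
  have bY: "norm (Y k x) \<le> B + norm a" for k x
    unfolding Y_def using norm_triangle_ineq4[of "X k x" a] bounded[of k x] by linarith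
  have B: "0 \<le> B + norm a" using order_trans[OF norm_ge_zero bY] .
  have [measurable]: "cnj \<in> borel_measurable borel"
    by (intro borel_measurable_continuous_onI continuous_intros)
  have iX: "integrable M (X k)" for k
    using bounded by (intro integrable_bounded) auto
  have iX': "integrable M (\<lambda>x. cnj (X k x))" for k
    using bounded by (intro integrable_bounded[of _ B]) auto
  have "B \<ge> 0" using order_trans[OF norm_ge_zero bounded] .
  then have iXX: "integrable M (\<lambda>x. X k x * cnj (X l x))" for k l
    using bounded by (intro integrable_bounded[of _ "B * B"]) (auto simp: norm_mult intro!: mult_mono)
  have iYY: "integrable M (\<lambda>x. Y k x * cnj (Y l x))" for k l
    using bY B by (intro integrable_bounded[of _ "(B + norm a) * (B + norm a)"])
      (auto simp: norm_mult intro!: mult_mono)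
  have YY: "(LINT x|M. Y k x * cnj (Y l x)) = r (k - l) - a * cnj a" if "l \<le> k" for k l
  proof -
    have "(LINT x|M. Y k x * cnj (Y l x)) =
        (LINT x|M. X k x * cnj (X l x) - cnj a * X k x - a * cnj (X l x) + a * cnj a)"
      by (simp add: Y_def algebra_simps)
    also have "\<dots> = r (k - l) - cnj a * a - a * cnj a + a * cnj a"
      using iX iX' iXX correlation[OF that] mean by (simp add: prob_space)
    finally show ?thesis by simp
  qed
  \<comment> \<open>Correlations are given for \<open>l \<le> k\<close> only; conjugation supplies
    the other half.\<close>
  have norm_YY: "norm (LINT x|M. Y k x * cnj (Y l x)) = e (if l \<le> k then k - l else l - k)" for k l
  proof (cases "l \<le> k")
    case True
    then show ?thesis by (simp add: YY e_def)
  next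
    case False
    have "(LINT x|M. Y k x * cnj (Y l x)) = (LINT x|M. cnj (Y l x * cnj (Y k x)))"
      by (simp add: mult.commute)
    also have "\<dots> = cnj (LINT x|M. Y l x * cnj (Y k x))" by (rule Bochner_Integration.integral_cnj)
    finally show ?thesis using False by (simp only: complex_mod_cnj) (simp add: YY e_def)
  qed
  have e_lim: "e \<longlonglongrightarrow> 0"
    using tendsto_norm[OF tendsto_diff[OF lim tendsto_const[of "a * cnj a"]]] by (simp add: e_def[abs_def])
  show ?thesis
  proof (rule Lim_null_comparison)
    have "(\<lambda>n. 2 * ((\<Sum>d<n. e d) / real n)) \<longlonglongrightarrow> 2 * 0"
      by (intro tendsto_mult tendsto_const mean_tendsto_zero e_lim)
    then show "(\<lambda>n. 2 * ((\<Sum>d<n. e d) / real n)) \<longlonglongrightarrow> 0" by simp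
    show "\<forall>\<^sub>F n in sequentially. norm (LINT x|M. (norm ((\<Sum>k<n. X k x) / of_nat n - a))\<^sup>2)
        \<le> 2 * ((\<Sum>d<n. e d) / real n)"
      using eventually_gt_at_top[of 0]
    proof eventually_elim
      case (elim n)
      have "complex_of_real ((norm ((\<Sum>k<n. X k x) / of_nat n - a))\<^sup>2) =
          (\<Sum>k<n. \<Sum>l<n. Y k x * cnj (Y l x)) / of_nat (n * n)" for x
      proof -
        have "(\<Sum>k<n. X k x) / of_nat n - a = (\<Sum>k<n. Y k x) / of_nat n"
          using elim by (simp add: Y_def sum_subtractf field_simps)
        then show ?thesis by (simp add: complex_norm_square sum_product del: of_real_power)
      qed
      then have "complex_of_real (LINT x|M. (norm ((\<Sum>k<n. X k x) / of_nat n - a))\<^sup>2) =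
          (\<Sum>k<n. \<Sum>l<n. LINT x|M. Y k x * cnj (Y l x)) / of_nat (n * n)"
        using iYY by (simp del: of_real_power flip: integral_complex_of_real)
      then have "norm (complex_of_real (LINT x|M. (norm ((\<Sum>k<n. X k x) / of_nat n - a))\<^sup>2)) =
          norm (\<Sum>k<n. \<Sum>l<n. LINT x|M. Y k x * cnj (Y l x)) / (real n * real n)"
        by (simp add: norm_divide norm_mult)
      also have "\<dots> \<le> (\<Sum>k<n. 2 * (\<Sum>d<n. e d)) / (real n * real n)"
      proof (intro divide_right_mono sum_norm_le)
        fix k assume "k \<in> {..<n}"
        then show "norm (\<Sum>l<n. LINT x|M. Y k x * cnj (Y l x)) \<le> 2 * (\<Sum>d<n. e d)"
          using sum_distance_le[of e k n]
          by (intro order_trans[OF norm_sum]) (simp add: norm_YY e_def)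
      qed simp
      also have "\<dots> = 2 * ((\<Sum>d<n. e d) / real n)" using elim by simp
      finally show ?case by (simp only: norm_of_real real_norm_def)
    qed
  qed
qed

section \<open>Mixing, atoms and singularity\<close>

lemma norm_sum_powers_le:
  fixes z :: complex
  assumes "norm z = 1" "z \<noteq> 1"
  shows "norm (\<Sum>n<N. z ^ n) \<le> 2 / norm (1 - z)"
proof -
  have "(\<Sum>n<N. z ^ n) = (1 - z ^ N) / (1 - z)"
    using assms by (simp add: sum_gp_strict)
  moreover have "norm (1 - z ^ N) \<le> 2"
    using norm_triangle_ineq4[of 1 "z ^ N"] assms by (simp add: norm_power)
  ultimately show ?thesis by (simp add: norm_divide divide_right_mono)
qed

text \<open>Wiener's way of isolating an atom: the geometric sums stay bounded unless
  \<open>t - x\<close> is an integer, which within \<open>{0..<1}\<close> means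
  \<open>t = x\<close>.\<close>

lemma mean_wave_tendsto:
  assumes "x \<in> {0..<1}" "t \<in> {0..<1}"
  shows "(\<lambda>N. (\<Sum>n<N. wave (int n) (t - x)) / of_nat N) \<longlonglongrightarrow> indicator {x} t"
proof (cases "t = x")
  case True
  have "\<forall>\<^sub>F N in sequentially. (\<Sum>n<N. wave (int n) (t - x)) / of_nat N = 1"
    using eventually_gt_at_top[of 0] by eventually_elim (simp add: True wave_def)
  then show ?thesis using True by (simp add: tendsto_eventually)
next
  case False
  define z where "z = wave 1 (t - x)"
  have "t - x \<notin> \<int>"
  proof
    assume "t - x \<in> \<int>"
    then obtain k where "t - x = of_int k" by (auto elim: Ints_cases)
    moreover from this have "k = 0" using assms by auto
    ultimately show False using False by simp
  qed
  then have z: "z \<noteq> 1" "norm z = 1" by (auto simp: z_def wave_1_eq_1_iff)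
  have "(\<lambda>N. (\<Sum>n<N. wave (int n) (t - x)) / of_nat N) \<longlonglongrightarrow> 0"
  proof (rule Lim_null_comparison)
    show "\<forall>\<^sub>F N in sequentially. norm ((\<Sum>n<N. wave (int n) (t - x)) / of_nat N)
        \<le> 2 / norm (1 - z) / real N"
    proof (intro always_eventually allI)
      fix N
      have "norm (\<Sum>n<N. wave (int n) (t - x)) \<le> 2 / norm (1 - z)"
        using norm_sum_powers_le[OF z(2,1), of N] wave_power[of _ 1 "t - x"] by (simp add: z_def)
      then show "norm ((\<Sum>n<N. wave (int n) (t - x)) / of_nat N) \<le> 2 / norm (1 - z) / real N"
        unfolding norm_divide norm_of_nat by (rule divide_right_mono) simp
    qed
    show "(\<lambda>N. 2 / norm (1 - z) / real N) \<longlonglongrightarrow> 0" by (rule lim_const_over_n)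
  qed
  then show ?thesis using False by simp
qed

context circle_distribution
begin

abbreviation coefficient :: "int \<Rightarrow> complex" where
  "coefficient m \<equiv> LINT t|M. wave m t"

lemma integrable_wave: "integrable M (wave m)"
  by (rule integrable_bounded[of _ 1]) auto

lemma coefficient_minus: "coefficient (- m) = cnj (coefficient m)"
  by (simp only: Bochner_Integration.integral_cnj[symmetric] cnj_wave)

text \<open>Mixing against approximations of the indicator of \<open>{x}\<close> gives
  \<open>wave (L ^ k) x * prob {x} \<longlonglongrightarrow> coefficient 1 * prob {x}\<close>.\<close>

lemma prob_singleton_eq_0:
  assumes mixing: "\<And>r. (\<lambda>k. coefficient (L ^ k + r)) \<longlonglongrightarrow> coefficient 1 * coefficient r"
    and less: "norm (coefficient 1) < 1"
  shows "prob {x} = 0"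
proof (cases "x \<in> {0..<1}")
  case False
  have "AE t in M. t \<noteq> x" using AE_unit by eventually_elim (use False in auto)
  then show ?thesis by (subst prob_eq_0) auto
next
  case True
  define p where "p = prob {x}"
  define P where "P N t = (\<Sum>n<N. wave (int n) (t - x)) / of_nat N" for N t
  have P_eq: "P N t = (\<Sum>n<N. wave (- int n) x / of_nat N * wave (int n) t)" for N t
    by (simp add: P_def wave_diff_arg sum_divide_distrib mult.commute)
  have [measurable]: "P N \<in> borel_measurable borel" for N
    unfolding P_eq[abs_def] by measurable
  have bP: "norm (P N t) \<le> 1" for N t
  proof -
    have "norm (\<Sum>n<N. wave (int n) (t - x)) \<le> (\<Sum>n<N. 1)" by (intro sum_norm_le) simp
    then show ?thesis by (cases "N = 0") (simp_all add: P_def norm_divide divide_le_eq_1)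
  qed
  have lim: "AE t in M. (\<lambda>N. P N t) \<longlonglongrightarrow> indicator {x} t"
    using AE_unit unfolding P_def by eventually_elim (rule mean_wave_tendsto[OF True])
  have iP: "integrable M (P N)" for N using bP by (intro integrable_bounded[of _ 1]) auto
  have ind: "(LINT t|M. indicator {x} t) = complex_of_real p"
  proof -
    have "(LINT t|M. indicator {x} t) = (LINT t|M. complex_of_real (indicator {x} t))"
      by (intro Bochner_Integration.integral_cong) (auto simp: indicator_def)
    then show ?thesis by (simp add: p_def)
  qed
  have int_P: "(\<lambda>N. LINT t|M. P N t) \<longlonglongrightarrow> of_real p"
  proof -
    have "(\<lambda>N. LINT t|M. P N t) \<longlonglongrightarrow> (LINT t|M. indicator {x} t)"
      using lim bP by (intro integral_dominated_convergence[where w = "\<lambda>_. 1"]) auto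
    then show ?thesis by (simp only: ind)
  qed
  \<comment> \<open>Mixing is applied to each fixed trigonometric polynomial \<open>P N\<close>;
    \<open>\<delta> N\<close> is the cost, uniform in \<open>k\<close>, of using \<open>P N\<close>
    in place of the indicator.\<close>
  define \<delta> where "\<delta> N = (LINT t|M. norm (P N t - indicator {x} t))" for N
  have \<delta>: "\<delta> \<longlonglongrightarrow> 0"
  proof -
    have "(\<lambda>N. LINT t|M. norm (P N t - indicator {x} t)) \<longlonglongrightarrow> (LINT t|M. 0)"
    proof (rule integral_dominated_convergence[where w = "\<lambda>_. 2"])
      show "AE t in M. (\<lambda>N. norm (P N t - indicator {x} t)) \<longlonglongrightarrow> 0"
        using lim by eventually_elim (intro tendsto_norm_zero, simp add: LIM_zero)
      have "norm (P N t - indicator {x} t) \<le> 1 + 1" for N t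
        using bP by (intro order_trans[OF norm_triangle_ineq4] add_mono) (auto simp: indicator_def)
      then show "AE t in M. norm (norm (P N t - indicator {x} t)) \<le> 2" for N by simp
    qed auto
    then show ?thesis by (simp add: \<delta>_def[abs_def])
  qed
  \<comment> \<open>Here \<open>N\<close> is fixed and \<open>k\<close> tends to infinity: mixing
    gives the limit, and the lower bound holds for every \<open>k\<close>.\<close>
  have lower: "p - \<delta> N \<le> norm (coefficient 1 * (LINT t|M. P N t))" for N
  proof (rule tendsto_lowerbound)
    have "(\<lambda>k. \<Sum>n<N. wave (- int n) x / of_nat N * coefficient (L ^ k + int n)) \<longlonglongrightarrow>
        (\<Sum>n<N. wave (- int n) x / of_nat N * (coefficient 1 * coefficient (int n)))"
      by (intro tendsto_sum tendsto_mult tendsto_const mixing)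
    also have "(\<Sum>n<N. wave (- int n) x / of_nat N * (coefficient 1 * coefficient (int n)))
        = coefficient 1 * (LINT t|M. P N t)"
      unfolding P_eq by (simp add: integrable_wave sum_distrib_left mult_ac)
    also have "(\<lambda>k. \<Sum>n<N. wave (- int n) x / of_nat N * coefficient (L ^ k + int n))
        = (\<lambda>k. LINT t|M. wave (L ^ k) t * P N t)"
    proof
      fix k
      have "wave (L ^ k) t * P N t = (\<Sum>n<N. wave (- int n) x / of_nat N * wave (L ^ k + int n) t)" for t
        by (simp add: P_eq wave_add sum_distrib_left mult_ac)
      then show "(\<Sum>n<N. wave (- int n) x / of_nat N * coefficient (L ^ k + int n))
          = (LINT t|M. wave (L ^ k) t * P N t)"
        by (simp add: integrable_wave)
    qed
    finally show "(\<lambda>k. norm (LINT t|M. wave (L ^ k) t * P N t)) \<longlonglongrightarrow> norm (coefficient 1 * (LINT t|M. P N t))"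
      by (rule tendsto_norm)
    have "p - \<delta> N \<le> norm (LINT t|M. wave (L ^ k) t * P N t)" for k
    proof -
      have i: "integrable M (\<lambda>t. wave (L ^ k) t * P N t)"
        using bP by (intro integrable_bounded[of _ 1]) (auto simp: norm_mult)
      have i': "integrable M (\<lambda>t. wave (L ^ k) t * indicator {x} t)"
        by (intro integrable_bounded[of _ 1]) (auto simp: norm_mult indicator_def)
      \<comment> \<open>On \<open>{x}\<close> the wave is a constant of modulus \<open>1\<close>, so
        the atom contributes exactly \<open>p\<close> for every \<open>k\<close>.\<close>
      have "(LINT t|M. wave (L ^ k) t * indicator {x} t) = (LINT t|M. wave (L ^ k) x * indicator {x} t)"
        by (intro Bochner_Integration.integral_cong) (auto simp: indicator_def)
      then have "p = norm (LINT t|M. wave (L ^ k) t * indicator {x} t)"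
        by (simp add: norm_mult ind) (simp add: p_def)
      also have "\<dots> \<le> norm (LINT t|M. wave (L ^ k) t * P N t) +
          norm (LINT t|M. wave (L ^ k) t * P N t - wave (L ^ k) t * indicator {x} t)"
        using i i' norm_triangle_sub[of "LINT t|M. wave (L ^ k) t * indicator {x} t"
            "LINT t|M. wave (L ^ k) t * P N t"]
        by (simp add: norm_minus_commute)
      also have "norm (LINT t|M. wave (L ^ k) t * P N t - wave (L ^ k) t * indicator {x} t) \<le> \<delta> N"
      proof -
        have "norm (wave (L ^ k) t * P N t - wave (L ^ k) t * indicator {x} t)
            = norm (P N t - indicator {x} t)" for t
          by (simp add: norm_mult flip: right_diff_distrib)
        then show ?thesis
          using integral_norm_bound[of M "\<lambda>t. wave (L ^ k) t * P N t - wave (L ^ k) t * indicator {x} t"]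
          by (simp add: \<delta>_def)
      qed
      finally show ?thesis by simp
    qed
    then show "\<forall>\<^sub>F k in sequentially. p - \<delta> N \<le> norm (LINT t|M. wave (L ^ k) t * P N t)" by simp
  qed simp
  \<comment> \<open>Now \<open>N\<close> tends to infinity.\<close>
  have "p - 0 \<le> norm (coefficient 1 * of_real p)"
  proof (rule LIMSEQ_le)
    show "(\<lambda>N. p - \<delta> N) \<longlonglongrightarrow> p - 0" by (intro tendsto_intros \<delta>)
    show "(\<lambda>N. norm (coefficient 1 * (LINT t|M. P N t))) \<longlonglongrightarrow> norm (coefficient 1 * of_real p)"
      by (intro tendsto_intros int_P)
  qed (use lower in auto)
  then have "p * (1 - norm (coefficient 1)) \<le> 0"
    by (simp add: norm_mult p_def algebra_simps)
  then have "p \<le> 0" using less by (simp add: mult_le_0_iff)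
  then show ?thesis using measure_nonneg[of M "{x}"] by (simp add: p_def)
qed

text \<open>The means of \<open>wave (L ^ k * m)\<close> tend to \<open>0\<close> almost everywhere for Lebesgue measure and to
  \<open>coefficient m\<close> almost everywhere for \<open>M\<close>, along a common subsequence.\<close>

lemma concentrated_on_null_set:
  assumes L: "2 \<le> L"
    and invariant: "\<And>k n. coefficient (L ^ k * n) = coefficient n"
    and mixing: "\<And>r. (\<lambda>k. coefficient (L ^ k * m + r)) \<longlonglongrightarrow> coefficient m * coefficient r"
    and m: "m \<noteq> 0" "coefficient m \<noteq> 0"
  obtains N where "N \<in> null_sets lborel" "emeasure M (- N) = 0"
proof -
  define X where "X k t = wave (L ^ k * m) t" for k :: nat and t
  define G where "G n t = (\<Sum>k<n. X k t) / of_nat n" for n t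
  have [measurable]: "X k \<in> borel_measurable borel" for k
    unfolding X_def[abs_def] by measurable
  have [measurable]: "G n \<in> borel_measurable borel" for n
    unfolding G_def[abs_def] by measurable
  \<comment> \<open>Invariance will remove the factor \<open>L ^ l\<close>, so that the correlation
    depends on \<open>k - l\<close> only.\<close>
  have XX: "X k t * cnj (X l t) = wave (L ^ l * (L ^ (k - l) * m + - m)) t" if "l \<le> k" for k l t
  proof -
    have "L ^ k = L ^ l * L ^ (k - l)" using that by (simp flip: power_add)
    then have "L ^ l * (L ^ (k - l) * m + - m) = L ^ k * m + - (L ^ l * m)" by (simp add: algebra_simps)
    then show ?thesis by (simp only: wave_add X_def cnj_wave)
  qed
  have bG: "norm (G n t) \<le> 1" for n t
  proof -
    have "norm (\<Sum>k<n. X k t) \<le> (\<Sum>k<n. 1)" by (intro sum_norm_le) (simp add: X_def)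
    then show ?thesis by (cases "n = 0") (simp_all add: G_def norm_divide divide_le_eq_1)
  qed
  have bG': "(norm (G n t - a))\<^sup>2 \<le> (1 + norm a)\<^sup>2" for n t a
    using bG[of n t] norm_triangle_ineq4[of "G n t" a] by (intro power_mono) auto
  define U :: "real measure" where "U = density lborel (indicator {0..1})"
  have U_ennreal: "U = density lborel (\<lambda>t. ennreal (indicator {0..1} t))"
    by (simp add: U_def ennreal_indicator)
  have [simp, measurable_cong]: "sets U = sets borel" by (simp add: U_def)
  have emeasure_U: "emeasure U A = emeasure lborel ({0..1} \<inter> A)" if "A \<in> sets borel" for A
    using that by (simp add: U_def emeasure_density flip: indicator_inter_arith)
  have wave_U: "(LINT t|U. wave n t) = (if n = 0 then 1 else 0)" for n
    using set_integral_wave[of n] by (simp add: U_ennreal integral_density set_lebesgue_integral_def)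
  interpret U: prob_space U
    by (rule prob_spaceI) (simp add: emeasure_U U_def emeasure_density)
  \<comment> \<open>For Lebesgue measure the \<open>X k\<close> are orthonormal:
    \<open>L ^ (k - l) * m = m\<close> forces \<open>k = l\<close>, as \<open>m \<noteq> 0\<close>
    and \<open>L \<ge> 2\<close>.\<close>
  have L2_U: "(\<lambda>n. LINT t|U. (norm (G n t - 0))\<^sup>2) \<longlonglongrightarrow> 0"
    unfolding G_def
  proof (rule U.mean_square_tendsto_zero[where B = 1 and r = "\<lambda>d. if d = 0 then 1 else 0"])
    show "(LINT t|U. X k t) = 0" for k using L m by (simp add: X_def wave_U)
    show "(LINT t|U. X k t * cnj (X l t)) = (if k - l = 0 then 1 else 0)" if "l \<le> k" for k l
    proof -
      have "L ^ l * (L ^ (k - l) * m + - m) = 0 \<longleftrightarrow> L ^ (k - l) = 1"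
        using L m by auto
      also have "\<dots> \<longleftrightarrow> k - l = 0"
      proof (cases "k - l = 0")
        case False
        then have "1 < L ^ (k - l)" using L by (intro one_less_power) auto
        then show ?thesis using False by simp
      qed simp
      finally show ?thesis using that by (simp only: XX wave_U)
    qed
    show "(\<lambda>d. if d = 0 then 1 else 0) \<longlonglongrightarrow> 0 * cnj 0"
      by (rule tendsto_eventually) (use eventually_gt_at_top[of 0] in \<open>auto elim: eventually_mono\<close>)
  qed (auto simp: X_def)
  \<comment> \<open>Invariance gives every \<open>X k\<close> the mean \<open>coefficient m\<close>;
    mixing with \<open>r = - m\<close> makes the covariances decay.\<close>
  have L2_M: "(\<lambda>n. LINT t|M. (norm (G n t - coefficient m))\<^sup>2) \<longlonglongrightarrow> 0"
    unfolding G_def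
  proof (rule mean_square_tendsto_zero[where B = 1 and r = "\<lambda>d. coefficient (L ^ d * m + - m)"])
    show "(LINT t|M. X k t) = coefficient m" for k by (simp add: X_def invariant)
    show "(LINT t|M. X k t * cnj (X l t)) = coefficient (L ^ (k - l) * m + - m)" if "l \<le> k" for k l
      using that by (simp only: XX invariant)
    show "(\<lambda>d. coefficient (L ^ d * m + - m)) \<longlonglongrightarrow> coefficient m * cnj (coefficient m)"
      using mixing[of "- m"] by (simp only: coefficient_minus)
  qed (auto simp: X_def)
  have "\<exists>r. strict_mono r \<and> (AE t in U. (\<lambda>n. (norm (G (r n) t - 0))\<^sup>2) \<longlonglongrightarrow> 0)"
  proof (rule tendsto_L1_AE_subseq)
    show "integrable U (\<lambda>t. (norm (G n t - 0))\<^sup>2)" for n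
      using bG'[of n _ 0] by (intro U.integrable_bounded[of _ "(1 + norm (0::complex))\<^sup>2"]) auto
  qed (use L2_U in simp)
  then obtain r where r: "strict_mono r"
    and AE_U: "AE t in U. (\<lambda>n. (norm (G (r n) t - 0))\<^sup>2) \<longlonglongrightarrow> 0" by blast
  \<comment> \<open>The second subsequence is taken inside the first, so both limits hold along
    \<open>r (q n)\<close>.\<close>
  have "\<exists>q. strict_mono q \<and> (AE t in M. (\<lambda>n. (norm (G (r (q n)) t - coefficient m))\<^sup>2) \<longlonglongrightarrow> 0)"
  proof (rule tendsto_L1_AE_subseq[where u = "\<lambda>n t. (norm (G (r n) t - coefficient m))\<^sup>2"])
    show "integrable M (\<lambda>t. (norm (G (r n) t - coefficient m))\<^sup>2)" for n
      using bG' by (intro integrable_bounded[of _ "(1 + norm (coefficient m))\<^sup>2"]) auto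
  qed (use LIMSEQ_subseq_LIMSEQ[OF L2_M r] in \<open>simp add: o_def\<close>)
  then obtain q where q: "strict_mono q"
    and AE_M: "AE t in M. (\<lambda>n. (norm (G (r (q n)) t - coefficient m))\<^sup>2) \<longlonglongrightarrow> 0" by blast
  obtain E1 where E1: "{t \<in> space U. \<not> (\<lambda>n. (norm (G (r n) t - 0))\<^sup>2) \<longlonglongrightarrow> 0} \<subseteq> E1"
    "emeasure U E1 = 0" "E1 \<in> sets U"
    using AE_U by (rule AE_E)
  obtain E2 where E2: "{t \<in> space M. \<not> (\<lambda>n. (norm (G (r (q n)) t - coefficient m))\<^sup>2) \<longlonglongrightarrow> 0} \<subseteq> E2"
    "emeasure M E2 = 0" "E2 \<in> sets M"
    using AE_M by (rule AE_E)
  have [measurable]: "E1 \<in> sets borel" "E2 \<in> sets borel" using E1 E2 by auto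
  \<comment> \<open>On \<open>N\<close> the means tend to \<open>coefficient m \<noteq> 0\<close>
    along the common subsequence, so they cannot tend to \<open>0\<close>; hence \<open>N\<close>
    lies in the Lebesgue-exceptional set \<open>E1\<close>.\<close>
  define N where "N = {0..<1} - E2"
  have [measurable]: "N \<in> sets borel" by (simp add: N_def)
  have "N \<subseteq> E1"
  proof (rule subsetI, rule ccontr)
    fix t assume t: "t \<in> N" "t \<notin> E1"
    have sq: "(\<lambda>n. g n) \<longlonglongrightarrow> a" if "(\<lambda>n. (norm (g n - a))\<^sup>2) \<longlonglongrightarrow> 0" for g :: "nat \<Rightarrow> complex" and a
      using tendsto_real_sqrt[OF that] by (simp add: LIM_zero_iff tendsto_norm_zero_iff)
    have "(\<lambda>n. G (r n) t) \<longlonglongrightarrow> 0" using t E1 by (intro sq) (auto simp: U_def)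
    then have "(\<lambda>n. G (r (q n)) t) \<longlonglongrightarrow> 0" using LIMSEQ_subseq_LIMSEQ q by (fastforce simp: o_def)
    moreover have "(\<lambda>n. G (r (q n)) t) \<longlonglongrightarrow> coefficient m"
      using t E2 by (intro sq) (auto simp: N_def)
    ultimately show False using m LIMSEQ_unique by blast
  qed
  then have "emeasure U N = 0" using E1 emeasure_mono[of N E1 U] by simp
  moreover have "{0..1} \<inter> N = N" by (auto simp: N_def)
  ultimately have "N \<in> null_sets lborel" by (simp add: emeasure_U null_sets_def)
  moreover have "emeasure M (- N) = 0"
  proof -
    have "AE t in M. t \<notin> E2" using E2 by (intro AE_not_in) (simp add: null_sets_def)
    with AE_unit have "AE t in M. t \<in> N" by eventually_elim (simp add: N_def)
    then show ?thesis
      by (subst AE_iff_measurable[symmetric, where P = "\<lambda>t. t \<in> N"]) auto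
  qed
  ultimately show thesis by (rule that)
qed

end

text \<open>The countably many integer translates of a null set carrying one period form a null set
  carrying the whole periodic measure.\<close>

lemma purely_singular_continuousI:
  assumes \<mu>: "is_fourier_transform \<eta> \<mu>"
    and atoms: "\<And>x. emeasure (unit_part \<mu>) {x} = 0"
    and N: "N \<in> null_sets lborel" "emeasure (unit_part \<mu>) (- N) = 0"
  shows "purely_singular_continuous \<mu>"
proof -
  have sets: "sets \<mu> = sets borel"
    and per: "\<forall>B\<in>sets borel. emeasure \<mu> ((+) 1 ` B) = emeasure \<mu> B"
    using \<mu> by (auto simp: is_fourier_transform_def)
  have "emeasure \<mu> {x} = 0" for x
  proof -
    have "(\<lambda>t. t + of_int k) -` {x} = {x - of_int k}" for k by auto
    then show ?thesis using periodic_emeasure_eq[OF sets per, of "{x}"] atoms by simp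
  qed
  moreover define N' where "N' = (\<Union>k::int. {t. t - of_int k \<in> N})"
  have null: "N' \<in> null_sets lborel"
    unfolding N'_def using N by (intro null_sets_UN' null_sets_translation) auto
  moreover have "emeasure \<mu> (- N') = 0"
  proof -
    have [measurable]: "N \<in> sets borel" "N' \<in> sets borel" using N null by (auto dest: null_setsD2)
    have "emeasure (unit_part \<mu>) ((\<lambda>t. t + of_int k) -` (- N')) = 0" for k
    proof -
      have "t + of_int k \<in> N'" if "t \<in> N" for t
        unfolding N'_def using that by (intro UN_I[of k]) auto
      then have "(\<lambda>t. t + of_int k) -` (- N') \<subseteq> - N" by auto
      then have "emeasure (unit_part \<mu>) ((\<lambda>t. t + of_int k) -` (- N')) \<le> emeasure (unit_part \<mu>) (- N)"
        using sets by (intro emeasure_mono) auto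
      then show ?thesis using N by simp
    qed
    then show ?thesis using periodic_emeasure_eq[OF sets per, of "- N'"] by simp
  qed
  ultimately have "singular_continuous \<mu>" by (auto simp: singular_continuous_def)
  then show ?thesis
    using sets by (auto simp: purely_singular_continuous_def lebesgue_decomposition_def pure_point_def
        absolutely_continuous_def null_sets_def)
qed

theorem (in block_sequence) purely_singular_continuous_diffraction:
  assumes "norm (autocorrelation f 1) < 1"
  shows "purely_singular_continuous (diffraction f)"
proof -
  define h where "h = autocorrelation f"
  note fixpoint = transfer_autocorrelation[folded h_def]
  note h_0 = autocorrelation_zero[folded h_def]
  have mixing: "(\<lambda>k. h (L ^ k * m + r)) \<longlonglongrightarrow> h m * h r" for m r
    by (rule transfer_fixpoint_mixing[OF fixpoint h_0 norm_autocorrelation[folded h_def]])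
  have lim: "(\<lambda>N. correlation_sum f N m / of_nat (2 * N + 1)) \<longlonglongrightarrow> h m" for m
    using correlation_mean_tendsto by (simp only: correlation_mean_def h_def)
  obtain M where M: "circle_distribution M" "\<And>m. (LINT t|M. wave m t) = h m"
    using exists_fourier_transform[OF norm_f lim] by blast
  interpret M: circle_distribution M by fact
  have ft: "is_fourier_transform h (periodise M)"
    using M.is_fourier_transform_periodise by (simp add: M(2))
  then have "diffraction f = periodise M"
    unfolding diffraction_def h_def[symmetric] by (intro the_equality is_fourier_transform_unique) auto
  moreover have "emeasure M {x} = 0" for x
    using M.prob_singleton_eq_0[of L x] mixing[of 1] assms
    by (simp add: M(2) h_def[symmetric] M.emeasure_eq_measure)
  moreover obtain m where "m \<noteq> 0" "h m \<noteq> 0"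
    using transfer_fixpoint_nonzero[OF fixpoint h_0] by blast
  then obtain N where "N \<in> null_sets lborel" "emeasure M (- N) = 0"
    using M.concentrated_on_null_set[OF L_ge_2, of m] mixing transfer_fixpoint_mult_power[OF fixpoint]
    unfolding M(2) by blast
  ultimately show ?thesis
    using purely_singular_continuousI[OF ft] by (simp add: M.unit_part_periodise)
qed

section \<open>From substitutions to block sequences\<close>

lemma shift_funpow: "(Defs.shift ^^ n) w k = w (k + int n)"
  by (induction n arbitrary: k) (simp_all add: Defs.shift_def algebra_simps)

theorem corollary4p4:
  fixes \<rho> :: "'a::{topological_ab_group_add, t2_space} \<Rightarrow> 'a list"
    and L :: nat and w :: "int \<Rightarrow> 'a" and chi :: "'a \<Rightarrow> complex"
  assumes "compact (UNIV :: 'a set)"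
    and "substitution \<rho>" and "constant_length \<rho> L"
    and "\<And>j. j < L \<Longrightarrow> group_translation (subst_column \<rho> j)"
    and "pseudo_fixed_point L \<rho> w"
    and "chi \<in> characters"
    and "norm (autocorrelation (\<lambda>m. chi (w m)) 1) < 1"
  shows "purely_singular_continuous (diffraction (\<lambda>m. chi (w m)))"
proof -
  have "2 \<le> L" using assms(2,3) by (auto simp: substitution_def constant_length_def)
  obtain \<beta> where \<beta>: "\<And>j a. j < L \<Longrightarrow> \<rho> a ! j = \<beta> j + a"
    using assms(4) unfolding group_translation_def subst_column_def by metis
  obtain s where s: "s < L" "subst_seq L \<rho> w = (Defs.shift ^^ s) w"
    using assms(5) by (auto simp: pseudo_fixed_point_def)
  have chi: "norm (chi a) = 1" "chi (a + b) = chi a * chi b" for a b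
    using assms(6) by (auto simp: characters_def)
  \<comment> \<open>The phases are the values of \<open>chi\<close> at the column translations:
    multiplicativity turns translating a letter into multiplying by a phase.\<close>
  interpret block_sequence "int L" "\<lambda>j. chi (\<beta> (nat j))" "int s" "\<lambda>m. chi (w m)"
  proof
    fix n
    have "w (n + int s) = subst_seq L \<rho> w n" by (simp add: s(2) shift_funpow)
    also have "\<dots> = \<beta> (nat (n mod int L)) + w (n div int L)"
      using \<open>2 \<le> L\<close> by (simp add: subst_seq_def \<beta> nat_less_iff)
    finally show "chi (w (n + int s)) = chi (\<beta> (nat (n mod int L))) * chi (w (n div int L))"
      by (simp add: chi)
  qed (use \<open>2 \<le> L\<close> s chi in auto)
  show ?thesis using assms(7) by (rule purely_singular_continuous_diffraction)
qed

end
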